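(* Let $\alpha_1,\alpha_2\in\mathbb S^1\setminus\Omega$ be parameters and let $p_1,p_2\in\mathbb PV$ be distinct nonisotropic nonorthogonal points such that the complex line $L:=\mathrm L(p_1,p_2)$ is noneuclidean. Put $\sigma_i:=\sigma p_i$, $\chi_i:=\mathrm{Im}\Big(\dfrac{\alpha_i}{\alpha_i^{-2}-\alpha_i}\Big)$ for $i=1,2$, and $$k_1:=\frac{1+4\chi_1\chi_2+\sigma_1\sigma_2\sqrt{(1+4\chi_1^2)(1+4\chi_2^2)}}{2}.$$ Then $R:=R_{\alpha_2}^{p_2}R_{\alpha_1}^{p_1}$ is $\bullet$ regular elliptic iff either $0<\mathrm{ta}(p_1,p_2)<1$ or ($L$ is hyperbolic and $\sigma_1\sigma_2\,\mathrm{ta}(p_1,p_2)<\sigma_1\sigma_2k_1$); $\bullet$ ellipto-parabolic iff $L$ is hyperbolic and $\mathrm{ta}(p_1,p_2)=k_1$; $\bullet$ loxodromic iff $L$ is hyperbolic and $\sigma_1\sigma_2\,\mathrm{ta}(p_1,p_2)>\sigma_1\sigma_2k_1$.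
   Context: Let $V$ be a 3-dimensional complex vector space with a Hermitian form $\langle-,-\rangle$ (linear in the first argument) of signature $++-$. The same letter denotes a point of $\mathbb PV$ and a representative. A point $p$ has signature $\sigma p\in\{-1,0,1\}$, the sign of $\langle p,p\rangle$ (negative, isotropic, positive). $\mathrm{SU}(2,1)$ is the group of determinant $1$ linear automorphisms of $V$ preserving the form; its elements are called isometries and their fixed points are the points of $\mathbb PV$ given by eigenvectors. $\mathbb S^1\subset\mathbb C$ is the unit circle and $\Omega$ the set of cube roots of unity. For nonisotropic $p$ and $\alpha\in\mathbb S^1$, $R_\alpha^p\in\mathrm{SU}(2,1)$ is $x\mapsto(\alpha^{-2}-\alpha)\frac{\langle x,p\rangle}{\langle p,p\rangle}p+\alpha x$. $\mathrm L(p_1,p_2)$ is the complex projective line through $p_1\neq p_2$; a line $\mathbb PW$ is hyperbolic, spherical, Euclidean when the form on $W$ has signature $+-$, $++$, $+0$. $\mathrm{ta}(p_1,p_2)=\frac{\langle p_1,p_2\rangle\langle p_2,p_1\rangle}{\langle p_1,p_1\rangle\langle p_2,p_2\rangle}$. A nonscalar isometry is elliptic if it has a negative fixed point (regular elliptic if its three eigenvalues are distinct), loxodromic if it has no negative and exactly two isotropic fixed points, parabolic if it has no negative and exactly one isotropic fixed point; a parabolic isometry is ellipto-parabolic if no multiple of it by a cube root of unity is unipotent. *)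

theory Defs
  imports "HOL-Analysis.Analysis"
begin

text \<open>
  The space \<open>V\<close> is \<open>complex^3\<close>, equipped with an arbitrary Hermitian form \<open>h\<close> of signature
  \<open>++-\<close>.  A point of the projective space is given by a nonzero representative \<open>p\<close>; the point
  itself is the complex span of \<open>p\<close>, written \<^term>\<open>vec.span {p}\<close>.
\<close>

type_synonym V = "complex^3"
type_synonym form = "V \<Rightarrow> V \<Rightarrow> complex"

definition hermitian_form :: "form \<Rightarrow> bool" where
  "hermitian_form h \<longleftrightarrow>
     (\<forall>y. Vector_Spaces.linear (*s) (*) (\<lambda>x. h x y)) \<and> (\<forall>x y. h y x = cnj (h x y))"

text \<open>The form restricted to the subspace \<open>W\<close> is diagonal with entries \<open>ss\<close> (each of them
  \<open>1\<close>, \<open>-1\<close> or \<open>0\<close>) in some basis \<open>bs\<close> of \<open>W\<close>.  By Sylvester's law \<open>W\<close> and \<open>h\<close> determine \<open>ss\<close>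
  up to order.\<close>

definition has_signature :: "form \<Rightarrow> V set \<Rightarrow> int list \<Rightarrow> bool" where
  "has_signature h W ss \<longleftrightarrow>
     (\<exists>bs. length bs = length ss \<and> distinct bs \<and>
           vec.independent (set bs) \<and> vec.span (set bs) = W \<and>
           (\<forall>i<length ss. \<forall>j<length ss.
              h (bs ! i) (bs ! j) = (if i = j then of_int (ss ! i) else 0)))"

definition sigma :: "form \<Rightarrow> V \<Rightarrow> real" where
  "sigma h p = sgn (Re (h p p))"

definition proj_line :: "V \<Rightarrow> V \<Rightarrow> V set" where
  "proj_line p q = vec.span {p, q}"

definition hyperbolic_line :: "form \<Rightarrow> V set \<Rightarrow> bool" where
  "hyperbolic_line h W \<longleftrightarrow> has_signature h W [1, -1]"

definition euclidean_line :: "form \<Rightarrow> V set \<Rightarrow> bool" where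
  "euclidean_line h W \<longleftrightarrow> has_signature h W [1, 0]"

text \<open>The quotient is a real number (see \<open>of_real_ta\<close> below); \<^term>\<open>Re\<close> only turns it into an
  element of type \<^typ>\<open>real\<close>.\<close>

definition ta :: "form \<Rightarrow> V \<Rightarrow> V \<Rightarrow> real" where
  "ta h p q = Re ((h p q * h q p) / (h p p * h q q))"

lemma of_real_ta:
  assumes "hermitian_form h"
  shows "complex_of_real (ta h p q) = (h p q * h q p) / (h p p * h q q)"
proof -
  have sym: "cnj (h x y) = h y x" for x y
    using assms unfolding hermitian_form_def by metis
  have "cnj ((h p q * h q p) / (h p p * h q q)) = (h p q * h q p) / (h p p * h q q)"
    by (simp add: sym mult.commute)
  then show ?thesis
    unfolding ta_def by (metis Reals_cnj_iff of_real_Re)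
qed

definition Omega :: "complex set" where
  "Omega = {\<omega>. \<omega> ^ 3 = 1}"

definition special_refl :: "form \<Rightarrow> complex \<Rightarrow> V \<Rightarrow> V \<Rightarrow> V" where
  "special_refl h \<alpha> p = (\<lambda>x. ((\<alpha> powi (-2) - \<alpha>) * (h x p / h p p)) *s p + \<alpha> *s x)"

definition SU :: "form \<Rightarrow> (V \<Rightarrow> V) set" where
  "SU h = {f. Vector_Spaces.linear (*s) (*s) f \<and> det (matrix f) = 1 \<and>
              (\<forall>x y. h (f x) (f y) = h x y)}"

definition scalar_map :: "(V \<Rightarrow> V) \<Rightarrow> bool" where
  "scalar_map f \<longleftrightarrow> (\<exists>c. f = (\<lambda>x. c *s x))"

definition eigenvalues :: "(V \<Rightarrow> V) \<Rightarrow> complex set" where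
  "eigenvalues f = {c. \<exists>v. v \<noteq> 0 \<and> f v = c *s v}"

text \<open>The fixed points of \<open>f\<close> in the projective space whose signature is \<open>s\<close>.  The sign of
  \<open>h v v\<close> does not depend on the representative \<open>v\<close>.\<close>

definition fixed_points_of_sign :: "form \<Rightarrow> (V \<Rightarrow> V) \<Rightarrow> real \<Rightarrow> V set set" where
  "fixed_points_of_sign h f s =
     {vec.span {v} | v. v \<noteq> 0 \<and> (\<exists>c. f v = c *s v) \<and> sigma h v = s}"

definition elliptic :: "form \<Rightarrow> (V \<Rightarrow> V) \<Rightarrow> bool" where
  "elliptic h f \<longleftrightarrow> f \<in> SU h \<and> \<not> scalar_map f \<and> fixed_points_of_sign h f (-1) \<noteq> {}"

definition regular_elliptic :: "form \<Rightarrow> (V \<Rightarrow> V) \<Rightarrow> bool" where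
  "regular_elliptic h f \<longleftrightarrow> elliptic h f \<and> card (eigenvalues f) = 3"

definition loxodromic :: "form \<Rightarrow> (V \<Rightarrow> V) \<Rightarrow> bool" where
  "loxodromic h f \<longleftrightarrow> f \<in> SU h \<and> \<not> scalar_map f \<and>
     fixed_points_of_sign h f (-1) = {} \<and> card (fixed_points_of_sign h f 0) = 2"

definition parabolic :: "form \<Rightarrow> (V \<Rightarrow> V) \<Rightarrow> bool" where
  "parabolic h f \<longleftrightarrow> f \<in> SU h \<and> \<not> scalar_map f \<and>
     fixed_points_of_sign h f (-1) = {} \<and> card (fixed_points_of_sign h f 0) = 1"

definition unipotent :: "(V \<Rightarrow> V) \<Rightarrow> bool" where
  "unipotent f \<longleftrightarrow> (\<exists>n::nat. (\<lambda>x. f x - x) ^^ n = (\<lambda>x. 0))"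

definition ellipto_parabolic :: "form \<Rightarrow> (V \<Rightarrow> V) \<Rightarrow> bool" where
  "ellipto_parabolic h f \<longleftrightarrow>
     parabolic h f \<and> (\<forall>\<omega>\<in>Omega. \<not> unipotent (\<lambda>x. \<omega> *s f x))"

definition chi :: "complex \<Rightarrow> real" where
  "chi \<alpha> = Im (\<alpha> / (\<alpha> powi (-2) - \<alpha>))"

end

theory Submission imports Defs
begin

text \<open>
  Let \<open>W\<close> be the plane spanned by \<open>p\<^sub>1\<close> and \<open>p\<^sub>2\<close>.  Since \<open>W\<close> is nondegenerate, \<open>R\<close> splits along
  \<open>W\<close> and its orthogonal complement, where it acts by \<open>\<alpha>\<^sub>1 \<alpha>\<^sub>2\<close>; this number is never an eigenvalue
  on \<open>W\<close>, because \<open>R x = \<alpha>\<^sub>1 \<alpha>\<^sub>2 x\<close> forces \<open>x\<close> to be orthogonal to both \<open>p\<^sub>1\<close> and \<open>p\<^sub>2\<close>.  On \<open>W\<close> the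
  determinant is \<open>(\<alpha>\<^sub>1 \<alpha>\<^sub>2)\<^sup>-\<^sup>1\<close>, and after division by its square root the trace becomes a real
  number that is an affine function of \<open>ta(p\<^sub>1, p\<^sub>2)\<close>.  Its absolute value is less than, equal to or
  greater than 2 according to whether the eigenvalues on \<open>W\<close> are distinct and unitary, equal, or
  distinct and not unitary.  In the last two cases the eigenvectors in \<open>W\<close> are isotropic; in the
  first one they are orthogonal, so one of them is negative if \<open>W\<close> is hyperbolic.  If \<open>W\<close> is
  spherical, the first case always occurs, and the orthogonal complement of \<open>W\<close> is negative.
\<close>

section \<open>Signatures of planes and spans of one or two vectors\<close>

lemma has_signature_2:
  "has_signature h W [s, t] \<longleftrightarrow>
     (\<exists>b c. b \<noteq> c \<and> vec.independent {b, c} \<and> vec.span {b, c} = W \<and>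
        h b b = of_int s \<and> h c c = of_int t \<and> h b c = 0 \<and> h c b = 0)"
proof
  assume "has_signature h W [s, t]"
  then obtain bs where bs: "length bs = Suc (Suc 0)" "distinct bs" "vec.independent (set bs)"
    "vec.span (set bs) = W"
    "\<And>i j. i < Suc (Suc 0) \<Longrightarrow> j < Suc (Suc 0) \<Longrightarrow>
      h (bs ! i) (bs ! j) = (if i = j then of_int ([s, t] ! i) else 0)"
    unfolding has_signature_def list.size add_0_right add_Suc_right add_0 by blast
  then obtain b c where "bs = [b, c]"
    by (auto simp: length_Suc_conv)
  with bs(5)[of 0 0] bs(5)[of 0 1] bs(5)[of 1 0] bs(5)[of 1 1] bs(2-4)
  show "\<exists>b c. b \<noteq> c \<and> vec.independent {b, c} \<and> vec.span {b, c} = W \<and>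
        h b b = of_int s \<and> h c c = of_int t \<and> h b c = 0 \<and> h c b = 0"
    by auto
next
  assume "\<exists>b c. b \<noteq> c \<and> vec.independent {b, c} \<and> vec.span {b, c} = W \<and>
        h b b = of_int s \<and> h c c = of_int t \<and> h b c = 0 \<and> h c b = 0"
  then obtain b c where "b \<noteq> c" "vec.independent {b, c}" "vec.span {b, c} = W"
        "h b b = of_int s" "h c c = of_int t" "h b c = 0" "h c b = 0"
    by blast
  then show "has_signature h W [s, t]"
    unfolding has_signature_def
    by (intro exI[of _ "[b, c]"]) (auto simp: less_Suc_eq)
qed

lemma span_pair: "vec.span {p, q :: 'a::field ^ 'n} = {s *s p + t *s q | s t. True}"
proof -
  have "x - s *s p = t *s q \<longleftrightarrow> x = s *s p + t *s q" for x s t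
    by (metis add_diff_cancel_left' diff_add_cancel add.commute)
  then show ?thesis
    by (auto simp: vec.span_insert vec.span_singleton image_iff)
qed

lemma span_singleton_scale:
  assumes "c \<noteq> 0"
  shows "vec.span {c *s v} = vec.span {v :: 'a::field ^ 'n}"
proof -
  have "v = (1 / c) *s (c *s v)"
    using assms by simp
  then have "v \<in> vec.span {c *s v}"
    by (metis vec.span_base vec.span_scale singletonI)
  moreover have "c *s v \<in> vec.span {v}"
    by (intro vec.span_scale vec.span_base) simp
  ultimately show ?thesis
    by (simp add: vec.span_eq)
qed

text \<open>A negative vector of the plane is the form in which hyperbolicity enters the eigenvector
  arguments below.\<close>

lemma hyperbolic_line_negative:
  assumes "hyperbolic_line h W"
  shows "\<exists>n\<in>W. Re (h n n) < 0"
proof -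
  obtain b c where "vec.span {b, c} = W" "h c c = of_int (-1)"
    using assms unfolding hyperbolic_line_def has_signature_2 by blast
  then have "c \<in> W" "Re (h c c) < 0"
    using vec.span_base[of c "{b, c}"] by auto
  then show ?thesis
    by blast
qed

section \<open>Hermitian forms, \<open>ta\<close>, and Gram-Schmidt in a complex line\<close>

locale hermitian =
  fixes h :: form
  assumes hermitian: "hermitian_form h"
begin

lemma form_linear: "Vector_Spaces.linear (*s) (*) (\<lambda>x. h x y)"
  using hermitian unfolding hermitian_form_def by blast

lemma cnj_form [simp]: "cnj (h x y) = h y x"
  using hermitian unfolding hermitian_form_def by metis

lemma form_add_left [simp]: "h (x + y) z = h x z + h y z"
  using form_linear[of z] by (simp add: Vector_Spaces.linear_iff)

lemma form_scale_left [simp]: "h (c *s x) z = c * h x z"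
  using form_linear[of z] by (simp add: Vector_Spaces.linear_iff)

lemma form_add_right [simp]: "h z (x + y) = h z x + h z y"
  by (metis cnj_form form_add_left complex_cnj_add)

lemma form_scale_right [simp]: "h z (c *s x) = cnj c * h z x"
  by (metis cnj_form form_scale_left complex_cnj_mult)

lemma form_diff_left [simp]: "h (x - y) z = h x z - h y z"
  by (metis form_add_left diff_add_cancel eq_diff_eq)

lemma form_diff_right [simp]: "h z (x - y) = h z x - h z y"
  by (metis form_add_right diff_add_cancel eq_diff_eq)

lemma form_zero_left [simp]: "h 0 z = 0"
  using form_diff_left[of 0 0 z] by simp

lemma form_self: "h x x = of_real (Re (h x x))"
  by (metis Reals_cnj_iff cnj_form of_real_Re)

lemma form_eq_0_commute: "h x y = 0 \<longleftrightarrow> h y x = 0"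
  by (metis cnj_form complex_cnj_zero)

lemma form_mult_commute: "h x y * h y x = of_real ((cmod (h x y))\<^sup>2)"
  unfolding complex_norm_square cnj_form ..

lemma ta_alt: "ta h p q = (cmod (h p q))\<^sup>2 / (Re (h p p) * Re (h q q))"
proof -
  have "h p p * h q q = of_real (Re (h p p) * Re (h q q))"
    by (metis form_self of_real_mult)
  then show ?thesis
    unfolding ta_def form_mult_commute by (simp del: of_real_mult of_real_power flip: of_real_divide)
qed

text \<open>The numerator of \<open>ta\<close> is a positive square, so only the signs in the
  denominator count. This links the sign of the root in \<open>k\<^sub>1\<close> to the sign of
  \<open>ta\<close>.\<close>

lemma sgn_ta: "sgn (ta h p q) = sigma h p * sigma h q" if "h p q \<noteq> 0"
proof -
  have "sgn (x / (y * z)) = sgn y * sgn z" if "x > 0" for x y z :: real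
    using that by (cases y "0::real" rule: linorder_cases; cases z "0::real" rule: linorder_cases)
      (simp_all add: zero_less_mult_iff mult_less_0_iff divide_pos_neg)
  then show ?thesis
    unfolding ta_alt sigma_def using that by (metis zero_less_power2 norm_eq_zero)
qed

lemma unit_vector:
  assumes "Re (h x x) \<noteq> 0"
  obtains c where "c \<noteq> 0" "h (c *s x) (c *s x) = of_real (sigma h x)"
proof
  let ?c = "1 / sqrt \<bar>Re (h x x)\<bar>"
  show "complex_of_real ?c \<noteq> 0"
    using assms by simp
  have "h (of_real ?c *s x) (of_real ?c *s x) = of_real ?c * of_real ?c * of_real (Re (h x x))"
    by (subst form_scale_left, subst form_scale_right, subst form_self) (simp only: complex_cnj_complex_of_real mult.assoc)
  also have "\<dots> = of_real (?c * ?c * Re (h x x))"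
    by (simp only: of_real_mult)
  also have "?c * ?c * Re (h x x) = sigma h x"
    using assms by (simp add: sigma_def sgn_if divide_simps)
  finally show "h (of_real ?c *s x) (of_real ?c *s x) = of_real (sigma h x)" .
qed

lemma has_signature_swap:
  assumes "has_signature h W [s, t]"
  shows "has_signature h W [t, s]"
proof -
  obtain b c where bc: "b \<noteq> c" "vec.independent {b, c}" "vec.span {b, c} = W"
    "h b b = of_int s" "h c c = of_int t" "h b c = 0" "h c b = 0"
    using assms unfolding has_signature_2 by blast
  then show ?thesis
    unfolding has_signature_2 by (intro exI[of _ c] exI[of _ b]) (auto simp: insert_commute[of c])
qed

text \<open>Gram-Schmidt: \<open>e\<close> is the component of \<open>q\<close> orthogonal to
  \<open>p\<close>, and \<open>c\<close>, \<open>d\<close> rescale the two vectors to the required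
  diagonal entries. Since \<open>t\<close> may be 0, Euclidean lines are covered.\<close>

lemma has_signature_lineI:
  assumes "h p p \<noteq> 0" "e = q - (h q p / h p p) *s p" "e \<noteq> 0" "c \<noteq> 0" "d \<noteq> 0"
    and c: "h (c *s p) (c *s p) = of_int s" and d: "h (d *s e) (d *s e) = of_int t"
  shows "has_signature h (proj_line p q) [s, t]"
proof -
  have ep: "h e p = 0"
    using assms by simp
  then have pe: "h p e = 0"
    using form_eq_0_commute by blast
  \<comment> \<open>Pairing with \<open>p\<close> annihilates \<open>e\<close> but not
    \<open>p\<close>.\<close>
  have notin: "c *s p \<notin> vec.span {d *s e}"
  proof
    assume "c *s p \<in> vec.span {d *s e}"
    then obtain k where "c *s p = k *s (d *s e)"
      by (auto simp: vec.span_singleton)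
    then have "h (c *s p) p = h (k *s (d *s e)) p"
      by (rule arg_cong)
    then have "c * h p p = k * (d * h e p)"
      by (simp only: form_scale_left)
    then show False
      using assms(1,4) ep by simp
  qed
  then have ne: "c *s p \<noteq> d *s e"
    by (metis vec.span_base singletonI)
  have "vec.span {c *s p, d *s e} = vec.span {p, q}"
  proof -
    have "c *s p \<in> vec.span {p, q}" "d *s e \<in> vec.span {p, q}"
      unfolding assms(2) by (intro vec.span_scale vec.span_diff vec.span_base; simp)+
    moreover have p: "p \<in> vec.span {c *s p, d *s e}"
      using vec.span_scale[OF vec.span_base, of "c *s p" "{c *s p, d *s e}" "1 / c"] \<open>c \<noteq> 0\<close>
      by simp
    moreover have "e \<in> vec.span {c *s p, d *s e}"
      using vec.span_scale[OF vec.span_base, of "d *s e" "{c *s p, d *s e}" "1 / d"] \<open>d \<noteq> 0\<close>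
      by simp
    then have "e + (h q p / h p p) *s p \<in> vec.span {c *s p, d *s e}"
      using p by (intro vec.span_add vec.span_scale)
    then have "q \<in> vec.span {c *s p, d *s e}"
      by (simp add: assms(2))
    ultimately show ?thesis
      by (simp add: vec.span_eq)
  qed
  moreover have "vec.independent {c *s p, d *s e}"
    using notin ne \<open>d \<noteq> 0\<close> \<open>e \<noteq> 0\<close> by (simp add: vec.independent_insert)
  ultimately show ?thesis
    unfolding has_signature_2 proj_line_def using ne c d
    by (intro exI[of _ "c *s p"] exI[of _ "d *s e"] conjI)
       (simp_all only: form_scale_left form_scale_right ep pe mult_zero_right not_False_eq_True)
qed

text \<open>The factor \<open>1 - ta h p q\<close> is the Gram determinant of \<open>p\<close> and
  \<open>q\<close> divided by \<open>h p p * h q q\<close>; hence \<open>ta\<close> and the sign of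
  \<open>q\<close> decide the sign of the second vector of an orthogonal basis.\<close>

lemma orthogonal_complement_line:
  assumes "h p p \<noteq> 0" "h q q \<noteq> 0" "e = q - (h q p / h p p) *s p"
  shows "h e p = 0" "Re (h e e) = Re (h q q) * (1 - ta h p q)"
proof -
  show ep: "h e p = 0"
    using assms by simp
  have "h e e = h e q - cnj (h q p / h p p) * h e p"
    unfolding assms(3) form_diff_right form_scale_right ..
  also have "\<dots> = h q q - h q p * h p q / h p p"
    using ep by (simp add: assms(3))
  also have "\<dots> = h q q * (1 - of_real (ta h p q))"
    using assms(1,2) by (simp add: of_real_ta[OF hermitian] field_simps)
  also have "\<dots> = of_real (Re (h q q) * (1 - ta h p q))"
    by (subst form_self) simp
  finally show "Re (h e e) = Re (h q q) * (1 - ta h p q)"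
    by simp
qed

section \<open>Special reflections as elements of \<open>SU h\<close>\<close>

lemma special_refl_form:
  "special_refl h \<alpha> p x = ((cnj \<alpha>)\<^sup>2 - \<alpha>) * (h x p / h p p) *s p + \<alpha> *s x" if "cmod \<alpha> = 1"
proof -
  have "inverse \<alpha> = cnj \<alpha>"
    using that by (metis complex_norm_square inverse_unique of_real_1 one_power2)
  then have "\<alpha> powi (-2) = (cnj \<alpha>)\<^sup>2"
    by (simp add: power_int_def power_inverse)
  then show ?thesis
    by (simp add: special_refl_def)
qed

lemma linear_special_refl: "Vector_Spaces.linear (*s) (*s) (special_refl h \<alpha> p)"
  unfolding special_refl_def Vector_Spaces.linear_iff
  by (auto simp: vec.vector_space_axioms vec_eq_iff algebra_simps add_divide_distrib diff_divide_distrib)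

text \<open>The map is \<alpha> times the identity plus a rank-one map, with matrix entries
  \<open>c * w j * p $ i\<close>. Its determinant is therefore \<alpha>^3 plus \<alpha>^2 times the
  trace of the rank-one part, and that trace is \<open>c * h p p\<close>.\<close>

lemma det_special_refl:
  assumes "h p p \<noteq> 0" "\<alpha> \<noteq> 0"
  shows "det (matrix (special_refl h \<alpha> p)) = 1"
proof -
  define c where "c = (\<alpha> powi (-2) - \<alpha>) / h p p"
  define w where "w j = h (axis j 1) p" for j
  have "p = p $ 1 *s axis 1 1 + p $ 2 *s axis 2 1 + p $ 3 *s axis 3 1"
    using basis_expansion[of p] by (simp only: sum_3)
  then have "h p p = h (p $ 1 *s axis 1 1 + p $ 2 *s axis 2 1 + p $ 3 *s axis 3 1) p"
    by (rule arg_cong)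
  then have w: "p $ 1 * w 1 + p $ 2 * w 2 + p $ 3 * w 3 = h p p"
    by (simp only: form_add_left form_scale_left w_def)
  have entry: "matrix (special_refl h \<alpha> p) $ i $ j = c * w j * p $ i + (if i = j then \<alpha> else 0)" for i j
    unfolding matrix_def special_refl_def c_def w_def by (simp add: axis_def)
  have "det (matrix (special_refl h \<alpha> p))
      = \<alpha> ^ 3 + \<alpha>\<^sup>2 * (c * (p $ 1 * w 1 + p $ 2 * w 2 + p $ 3 * w 3))"
    unfolding det_3 entry by (simp add: algebra_simps power2_eq_square power3_eq_cube)
  also have "\<dots> = \<alpha> ^ 3 + \<alpha>\<^sup>2 * (\<alpha> powi (-2) - \<alpha>)"
    using assms by (simp add: w c_def)
  also have "\<dots> = 1"
    using assms by (simp add: power_int_def power_inverse field_simps power2_eq_square power3_eq_cube)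
  finally show ?thesis .
qed

lemma special_refl_isometry:
  assumes "h p p \<noteq> 0" "cmod \<alpha> = 1"
  shows "h (special_refl h \<alpha> p x) (special_refl h \<alpha> p y) = h x y"
proof -
  have [simp]: "\<alpha> * cnj \<alpha> = 1"
    using assms by (metis complex_norm_square of_real_1 one_power2)
  let ?c = "(cnj \<alpha>)\<^sup>2 - \<alpha>"
  \<comment> \<open>This is the coefficient of \<open>h x p * h p y / h p p\<close> in the expanded
    form. Adding \<alpha> to \<open>?c\<close> gives the square of \<open>cnj \<alpha>\<close>, the
    eigenvalue at \<open>p\<close>, so the coefficient vanishes because both eigenvalues are
    unitary.\<close>
  have "?c * cnj ?c + ?c * cnj \<alpha> + \<alpha> * cnj ?c = (\<alpha> * cnj \<alpha>)\<^sup>2 - \<alpha> * cnj \<alpha>"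
    by (simp only: complex_cnj_diff complex_cnj_power complex_cnj_cnj) algebra
  then have c: "?c * cnj ?c + ?c * cnj \<alpha> + \<alpha> * cnj ?c = 0"
    by simp
  have "h (c * (h x p / h p p) *s p + \<alpha> *s x) (c * (h y p / h p p) *s p + \<alpha> *s y)
     = (c * cnj c + c * cnj \<alpha> + \<alpha> * cnj c) * (h x p * h p y / h p p) + (\<alpha> * cnj \<alpha>) * h x y" for c
    using assms(1) by (simp add: field_simps del: \<open>\<alpha> * cnj \<alpha> = 1\<close>)
  from this[of ?c] c show ?thesis
    unfolding special_refl_form[OF assms(2)] by simp
qed

lemma special_refl_SU:
  assumes "h p p \<noteq> 0" "cmod \<alpha> = 1"
  shows "special_refl h \<alpha> p \<in> SU h"
  using assms linear_special_refl det_special_refl[of p \<alpha>] special_refl_isometry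
  by (fastforce simp: SU_def)

lemma SU_comp:
  assumes "f \<in> SU h" "g \<in> SU h"
  shows "f \<circ> g \<in> SU h"
  using assms unfolding SU_def
  by (auto simp: matrix_compose_gen det_mul intro: Vector_Spaces.linear_compose)

end

section \<open>Consequences of the signature ++-: types of lines in terms of
  \<open>ta\<close>\<close>

locale lorentzian = hermitian +
  assumes signature: "has_signature h UNIV [1, 1, -1]"
begin

lemma orthonormal_basis:
  obtains b c d where "vec.span {b, c, d} = UNIV"
    "h b b = 1" "h c c = 1" "h d d = -1" "h b c = 0" "h b d = 0" "h c d = 0"
proof -
  from signature obtain bs where bs: "length bs = Suc (Suc (Suc 0))" "vec.span (set bs) = UNIV"
    "\<And>i j. i < Suc (Suc (Suc 0)) \<Longrightarrow> j < Suc (Suc (Suc 0)) \<Longrightarrow>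
      h (bs ! i) (bs ! j) = (if i = j then of_int ([1, 1, -1] ! i) else 0)"
    unfolding has_signature_def list.size add_0_right add_Suc_right add_0 by blast
  then obtain b c d where "bs = [b, c, d]"
    by (auto simp: length_Suc_conv)
  note [simp] = this
  from bs(3)[of 0 0] bs(3)[of 0 1] bs(3)[of 0 "Suc 1"] bs(3)[of 1 1]
    bs(3)[of 1 "Suc 1"] bs(3)[of "Suc 1" "Suc 1"]
  have "h b b = 1 \<and> h c c = 1 \<and> h d d = -1 \<and> h b c = 0 \<and> h b d = 0 \<and> h c d = 0"
    by simp
  moreover have "vec.span {b, c, d} = UNIV"
    using bs(2) by simp
  ultimately show thesis
    using that by blast
qed

lemma negative_vector: obtains n where "Re (h n n) < 0"
proof -
  obtain d where "h d d = -1"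
    using orthonormal_basis by metis
  then show thesis
    by (intro that[of d]) simp
qed

text \<open>In orthonormal coordinates, orthogonality and Cauchy-Schwarz bound |w w'|^2 by (|u|^2 +
  |v|^2)(|u'|^2 + |v'|^2), whose last factor is less than |w'|^2 because \<open>n\<close> is
  negative. If \<open>x\<close> were not positive, this would force \<open>w = 0\<close> and then
  \<open>x = 0\<close>.\<close>

lemma orthogonal_negative:
  assumes n: "Re (h n n) < 0" and "h x n = 0" and "x \<noteq> 0"
  shows "Re (h x x) > 0"
proof -
  obtain b c d where span: "vec.span {b, c, d} = UNIV"
    and hb: "h b b = 1" "h c c = 1" "h d d = -1" "h b c = 0" "h b d = 0" "h c d = 0"
    by (rule orthonormal_basis)
  have hb': "h c b = 0" "h d b = 0" "h d c = 0"
    using hb by (metis form_eq_0_commute)+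
  have coords: "\<exists>u v w. y = u *s b + v *s c + w *s d" for y
  proof -
    have "y \<in> vec.span {b, c, d}"
      using span by simp
    then obtain u v w where "y - u *s b - v *s c = w *s d"
      by (auto simp: vec.span_insert vec.span_singleton)
    then have "y = u *s b + v *s c + w *s d"
      by (simp add: algebra_simps)
    then show ?thesis
      by blast
  qed
  obtain u v w where x: "x = u *s b + v *s c + w *s d"
    using coords by blast
  obtain u' v' w' where n': "n = u' *s b + v' *s c + w' *s d"
    using coords by blast
  have self: "Re (h y y) = (cmod r)\<^sup>2 + (cmod s)\<^sup>2 - (cmod t)\<^sup>2"
    if "y = r *s b + s *s c + t *s d" for y r s t
  proof -
    have "h y y = r * cnj r + s * cnj s - t * cnj t"
      unfolding that using hb hb' by (simp add: algebra_simps)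
    also have "\<dots> = of_real ((cmod r)\<^sup>2 + (cmod s)\<^sup>2 - (cmod t)\<^sup>2)"
      by (simp only: complex_norm_square of_real_add of_real_diff)
    finally have "h y y = \<dots>" .
    then show ?thesis
      by simp
  qed
  have "h x n = u * cnj u' + v * cnj v' - w * cnj w'"
    unfolding x n' using hb hb' by (simp add: algebra_simps)
  then have "w * cnj w' = u * cnj u' + v * cnj v'"
    using assms(2) by simp
  then have "cmod w * cmod w' \<le> cmod u * cmod u' + cmod v * cmod v'"
    by (metis norm_triangle_ineq norm_mult complex_mod_cnj)
  then have "(cmod w * cmod w')\<^sup>2 \<le> (cmod u * cmod u' + cmod v * cmod v')\<^sup>2"
    by (intro power_mono) auto
  \<comment> \<open>Cauchy-Schwarz for pairs; the two sides differ by the square supplied to the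
    simplifier.\<close>
  also have "\<dots> \<le> ((cmod u)\<^sup>2 + (cmod v)\<^sup>2) * ((cmod u')\<^sup>2 + (cmod v')\<^sup>2)"
    using zero_le_power2[of "cmod u * cmod v' - cmod v * cmod u'"]
    by (simp add: power2_eq_square algebra_simps)
  finally have le: "(cmod w)\<^sup>2 * (cmod w')\<^sup>2 \<le> ((cmod u)\<^sup>2 + (cmod v)\<^sup>2) * ((cmod u')\<^sup>2 + (cmod v')\<^sup>2)"
    by (simp add: power_mult_distrib)
  have lt: "(cmod u')\<^sup>2 + (cmod v')\<^sup>2 < (cmod w')\<^sup>2"
    using n self[OF n'] by simp
  show ?thesis
  proof (rule ccontr)
    assume "\<not> ?thesis"
    then have le': "(cmod u)\<^sup>2 + (cmod v)\<^sup>2 \<le> (cmod w)\<^sup>2"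
      using self[OF x] by simp
    have "(cmod w)\<^sup>2 * (cmod w')\<^sup>2 \<le> (cmod w)\<^sup>2 * ((cmod u')\<^sup>2 + (cmod v')\<^sup>2)"
      using le mult_right_mono[OF le', of "(cmod u')\<^sup>2 + (cmod v')\<^sup>2"] by simp
    then have "w = 0"
      using lt by (auto simp: mult_le_cancel_left)
    with le' have "u = 0" "v = 0"
      by (auto simp: sum_power2_le_zero_iff)
    with \<open>w = 0\<close> x \<open>x \<noteq> 0\<close> show False
      by simp
  qed
qed

text \<open>If \<open>ta\<close> were 1, the component \<open>e\<close> of \<open>q\<close>
  orthogonal to \<open>p\<close> would be isotropic, and it is nonzero because the points differ. A
  negative \<open>p\<close> would make \<open>e\<close> positive; so \<open>p\<close> is positive
  and the line is Euclidean.\<close>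

lemma ta_neq_1:
  assumes "Re (h p p) \<noteq> 0" "Re (h q q) \<noteq> 0" "vec.span {p} \<noteq> vec.span {q}"
    and "\<not> euclidean_line h (proj_line p q)"
  shows "ta h p q \<noteq> 1"
proof
  assume ta: "ta h p q = 1"
  have pq: "h p p \<noteq> 0" "h q q \<noteq> 0"
    using assms(1,2) by auto
  define e where "e = q - (h q p / h p p) *s p"
  note e = orthogonal_complement_line[OF pq e_def]
  have "h e e = 0"
    using e(2) ta by (subst form_self) simp
  have "e \<noteq> 0"
  proof
    assume "e = 0"
    then have q: "q = (h q p / h p p) *s p"
      by (simp add: e_def)
    then have "h q p / h p p \<noteq> 0"
      using pq by (metis form_zero_left vec.scale_zero_left)
    then show False
      using assms(3) q span_singleton_scale by metis
  qed
  have "\<not> Re (h p p) < 0"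
    using orthogonal_negative[of p e] e(1) \<open>e \<noteq> 0\<close> \<open>h e e = 0\<close> by auto
  with assms(1) have "sigma h p = 1"
    by (simp add: sigma_def)
  then obtain c where "c \<noteq> 0" "h (c *s p) (c *s p) = 1"
    using unit_vector[OF assms(1)] by auto
  then have "has_signature h (proj_line p q) [1, 0]"
    using has_signature_lineI[OF pq(1) e_def \<open>e \<noteq> 0\<close> \<open>c \<noteq> 0\<close>, of 1 1 0] \<open>h e e = 0\<close> by simp
  with assms(4) show False
    by (simp add: euclidean_line_def)
qed

text \<open>Here \<open>p\<close> and \<open>q\<close> have the same sign. Were both negative,
  \<open>e\<close> would be positive as a vector orthogonal to \<open>p\<close>, but negative by
  \<open>orthogonal_complement_line\<close>. So \<open>p\<close> and \<open>e\<close> form an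
  orthogonal basis of positive vectors.\<close>

lemma spherical_line:
  assumes "Re (h p p) \<noteq> 0" "Re (h q q) \<noteq> 0" "0 < ta h p q" "ta h p q < 1"
  shows "Re (h p p) > 0" "x \<in> proj_line p q \<Longrightarrow> Re (h x x) \<ge> 0"
proof -
  have pq: "h p p \<noteq> 0" "h q q \<noteq> 0"
    using assms(1,2) by auto
  define e where "e = q - (h q p / h p p) *s p"
  note e = orthogonal_complement_line[OF pq e_def]
  have "e \<noteq> 0"
    using e(2) assms by auto
  have same: "Re (h p p) * Re (h q q) > 0"
    using assms(3) by (auto simp: ta_alt zero_less_divide_iff)
  show p: "Re (h p p) > 0"
  proof (rule ccontr)
    assume "\<not> ?thesis"
    then have neg: "Re (h p p) < 0" "Re (h q q) < 0"
      using same assms(1) by (auto simp: zero_less_mult_iff)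
    then have "Re (h e e) > 0"
      using orthogonal_negative e(1) \<open>e \<noteq> 0\<close> by blast
    with neg show False
      using e(2) assms(4) by (simp add: zero_less_mult_iff)
  qed
  assume "x \<in> proj_line p q"
  then obtain s t where x: "x = s *s p + t *s q"
    by (auto simp: proj_line_def span_pair)
  define a where "a = s + t * (h q p / h p p)"
  have x': "x = a *s p + t *s e"
    by (simp add: x a_def e_def vec_eq_iff algebra_simps)
  have "h p e = 0"
    using e(1) form_eq_0_commute by blast
  then have "h x x = of_real ((cmod a)\<^sup>2) * h p p + of_real ((cmod t)\<^sup>2) * h e e"
    using e(1) unfolding complex_norm_square x'
    by (simp only: form_add_left form_add_right form_scale_left form_scale_right) (simp add: algebra_simps)
  then have "Re (h x x) = (cmod a)\<^sup>2 * Re (h p p) + (cmod t)\<^sup>2 * (Re (h q q) * (1 - ta h p q))"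
    using e(2) by (simp del: of_real_power)
  moreover have "Re (h q q) > 0"
    using p same by (simp add: zero_less_mult_iff)
  ultimately show "Re (h x x) \<ge> 0"
    using p assms(4) by simp
qed

text \<open>A negative vector contradicts \<open>spherical_line\<close>. Conversely, for
  \<open>ta\<close> outside the unit interval the orthogonal vectors \<open>p\<close> and
  \<open>e\<close> turn out to have opposite signs.\<close>

lemma hyperbolic_line_iff:
  assumes "Re (h p p) \<noteq> 0" "Re (h q q) \<noteq> 0" "h p q \<noteq> 0" "ta h p q \<noteq> 1"
  shows "hyperbolic_line h (proj_line p q) \<longleftrightarrow> \<not> (0 < ta h p q \<and> ta h p q < 1)"
proof
  assume "hyperbolic_line h (proj_line p q)"
  then obtain n where "n \<in> proj_line p q" "Re (h n n) < 0"
    using hyperbolic_line_negative by blast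
  then show "\<not> (0 < ta h p q \<and> ta h p q < 1)"
    using spherical_line(2)[OF assms(1,2), of n] by auto
next
  assume ta: "\<not> (0 < ta h p q \<and> ta h p q < 1)"
  have pq: "h p p \<noteq> 0" "h q q \<noteq> 0"
    using assms(1,2) by auto
  define e where "e = q - (h q p / h p p) *s p"
  note e = orthogonal_complement_line[OF pq e_def]
  have e0: "Re (h e e) \<noteq> 0"
    using e(2) assms by simp
  then have "e \<noteq> 0"
    by auto
  note sgn_ta = sgn_ta[OF assms(3)]
  have sgn_e: "sigma h e = sigma h q * sgn (1 - ta h p q)"
    by (simp add: sigma_def e(2) sgn_mult)
  \<comment> \<open>For \<open>ta > 1\<close> the points have equal signs and \<open>1 - ta\<close>
    flips that of \<open>e\<close>; for \<open>ta < 0\<close> the points already differ in sign and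
    \<open>1 - ta\<close> is positive.\<close>
  have opp: "sigma h e = - sigma h p"
  proof (cases "ta h p q > 1")
    case True
    then have "sigma h p * sigma h q = 1"
      using sgn_ta by simp
    then have "sigma h p = sigma h q"
      by (auto simp: sigma_def sgn_if split: if_splits)
    with True sgn_e show ?thesis
      by simp
  next
    case False
    have "ta h p q \<noteq> 0"
      using assms by (simp add: ta_alt)
    with False ta assms(4) have "ta h p q < 0"
      by auto
    then have "sigma h p * sigma h q = -1"
      using sgn_ta by simp
    then have "sigma h q = - sigma h p"
      by (auto simp: sigma_def sgn_if split: if_splits)
    with \<open>ta h p q < 0\<close> sgn_e show ?thesis
      by simp
  qed
  obtain c where c: "c \<noteq> 0" "h (c *s p) (c *s p) = of_real (sigma h p)"
    by (rule unit_vector[OF assms(1)])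
  obtain d where d: "d \<noteq> 0" "h (d *s e) (d *s e) = of_real (sigma h e)"
    by (rule unit_vector[OF e0])
  note sig = has_signature_lineI[OF pq(1) e_def \<open>e \<noteq> 0\<close> c(1) d(1)]
  show "hyperbolic_line h (proj_line p q)"
  proof (cases "sigma h p = 1")
    case True
    then show ?thesis
      unfolding hyperbolic_line_def using sig[of 1 "-1"] c(2) d(2) opp by simp
  next
    case False
    then have "sigma h p = -1"
      using assms(1) by (auto simp: sigma_def sgn_if)
    then have "has_signature h (proj_line p q) [-1, 1]"
      using sig[of "-1" 1] c(2) d(2) opp by simp
    then show ?thesis
      unfolding hyperbolic_line_def by (rule has_signature_swap)
  qed
qed

end

section \<open>Arithmetic of the reflection parameters\<close>

text \<open>The quotient has real part -1/2, so \<open>chi\<close> carries all its information. The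
  second equation computes its squared modulus and shows that \<open>\<alpha> * c\<^sup>2\<close> is
  a negative real number, which later makes the normalized trace real.\<close>

lemma quotient_chi:
  assumes "cmod \<alpha> = 1" "\<alpha> ^ 3 \<noteq> 1"
  defines "c \<equiv> \<alpha> powi (-2) - \<alpha>"
  shows "\<alpha> / c = Complex (-1/2) (chi \<alpha>)"
    and "of_real (1 + 4 * (chi \<alpha>)\<^sup>2) * (\<alpha> * c\<^sup>2) = -4"
proof -
  have unit: "\<alpha> * cnj \<alpha> = 1"
    using assms by (metis complex_norm_square of_real_1 one_power2)
  then have "inverse \<alpha> = cnj \<alpha>"
    by (rule inverse_unique)
  then have powi: "\<alpha> powi (-2) = (cnj \<alpha>)\<^sup>2"
    by (simp add: power_int_def power_inverse)
  have c: "c = (cnj \<alpha>)\<^sup>2 - \<alpha>" "cnj c = \<alpha>\<^sup>2 - cnj \<alpha>"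
    by (simp_all add: c_def powi)
  have "c \<noteq> 0"
  proof
    assume "c = 0"
    then have "\<alpha> ^ 3 = (\<alpha> * cnj \<alpha>)\<^sup>2"
      using c(1) by algebra
    with assms(2) unit show False
      by simp
  qed
  let ?w = "\<alpha> / c"
  \<comment> \<open>Both sides equal \<alpha>^3 + (cnj \<alpha>)^3 - 2.\<close>
  have "\<alpha> * cnj c + cnj \<alpha> * c = - (c * cnj c)"
    unfolding c(2) unfolding c(1) using unit by algebra
  then have sum: "?w + cnj ?w = -1"
    using \<open>c \<noteq> 0\<close> by (simp add: add_frac_eq)
  have "2 * Re ?w = Re (?w + cnj ?w)"
    unfolding complex_add_cnj by simp
  then have "Re ?w = -1/2"
    unfolding sum by simp
  then show w: "?w = Complex (-1/2) (chi \<alpha>)"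
    by (simp add: complex_eq_iff chi_def c_def)
  have "of_real (1 + 4 * (chi \<alpha>)\<^sup>2) = 4 * (?w * cnj ?w)"
    unfolding w by (simp add: complex_eq_iff power2_eq_square)
  also have "cnj ?w = - 1 - ?w"
    using sum by (simp add: algebra_simps add_eq_0_iff)
  finally have chi: "of_real (1 + 4 * (chi \<alpha>)\<^sup>2) = 4 * (?w * (- 1 - ?w))" .
  have "\<alpha> = ?w * c"
    using \<open>c \<noteq> 0\<close> by simp
  with chi have "of_real (1 + 4 * (chi \<alpha>)\<^sup>2) * (\<alpha> * c\<^sup>2) = - 4 * (\<alpha>\<^sup>2 * (c + \<alpha>))"
    by algebra
  \<comment> \<open>Here \<open>c + \<alpha>\<close> is the square of
    \<open>cnj \<alpha>\<close>.\<close>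
  also have "\<alpha>\<^sup>2 * (c + \<alpha>) = (\<alpha> * cnj \<alpha>)\<^sup>2"
    unfolding c by algebra
  finally show "of_real (1 + 4 * (chi \<alpha>)\<^sup>2) * (\<alpha> * c\<^sup>2) = -4"
    by (simp add: unit)
qed

section \<open>The product of two reflections on the plane of \<open>p\<close> and
  \<open>q\<close>\<close>

locale reflection_pair = lorentzian +
  fixes \<alpha> \<beta> :: complex and p q :: V
  assumes unit: "cmod \<alpha> = 1" "cmod \<beta> = 1"
    and not_cube_root: "\<alpha> ^ 3 \<noteq> 1" "\<beta> ^ 3 \<noteq> 1"
    and nonisotropic: "h p p \<noteq> 0" "h q q \<noteq> 0"
    and nonorthogonal: "h p q \<noteq> 0"
    and nondegenerate: "h p p * h q q \<noteq> h p q * h q p"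
begin

definition R :: "V \<Rightarrow> V" where
  "R = special_refl h \<beta> q \<circ> special_refl h \<alpha> p"

text \<open>The sum of the \<open>p\<close>-coefficient of \<open>R p\<close> and the
  \<open>q\<close>-coefficient of \<open>R q\<close>, computed in \<open>R_p\<close> and
  \<open>R_q\<close> below.\<close>

definition tr :: complex where
  "tr = \<alpha> powi (-2) * \<beta> + \<alpha> * \<beta> powi (-2)
      + (\<alpha> powi (-2) - \<alpha>) * (\<beta> powi (-2) - \<beta>) * (h p q * h q p / (h p p * h q q))"

text \<open>Within the plane each reflection has one eigenvalue at its own point and another on the
  orthogonal complement; the two factors are the products of these pairs.\<close>

definition dt :: complex where
  "dt = \<alpha> powi (-2) * \<alpha> * (\<beta> powi (-2) * \<beta>)"

text \<open>By Cayley-Hamilton on the plane, \<open>R - \<mu>\<close> annihilates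
  \<open>(R - (tr - \<mu>)) p\<close> whenever \<mu> is a root of the characteristic
  polynomial.\<close>

definition eigvec :: "complex \<Rightarrow> V" where
  "eigvec \<mu> = R p - (tr - \<mu>) *s p"

lemma nonzero: "\<alpha> \<noteq> 0" "\<beta> \<noteq> 0" "\<alpha> powi (-2) \<noteq> 0" "\<beta> powi (-2) \<noteq> 0"
  using unit by auto

lemma coeff_nonzero: "z powi (-2) - z \<noteq> 0" if "z \<noteq> 0" "z ^ 3 \<noteq> 1" for z :: complex
proof
  assume "z powi (-2) - z = 0"
  then have "z ^ 2 * z powi (-2) = z ^ 3"
    by (simp add: power2_eq_square power3_eq_cube)
  moreover have "z ^ 2 * z powi (-2) = 1"
    using that by (simp add: power_int_def power_inverse)
  ultimately show False
    using that by simp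
qed

lemma dt_eq: "dt * (\<alpha> * \<beta>) = 1"
  using nonzero by (simp add: dt_def power_int_def power_inverse power2_eq_square field_simps)

lemma R_SU: "R \<in> SU h"
  unfolding R_def using nonisotropic unit by (intro SU_comp special_refl_SU)

lemma R_add: "R (x + y) = R x + R y" and R_scale: "R (c *s x) = c *s R x"
  using R_SU by (auto simp: SU_def Vector_Spaces.linear_iff)

lemma R_diff: "R (x - y) = R x - R y"
  by (metis R_add add_diff_cancel diff_add_cancel)

lemma R_isometry: "h (R x) (R y) = h x y"
  using R_SU by (simp add: SU_def)

text \<open>Displays \<open>R\<close> minus the scalar \<alpha>\<beta> as a map into the plane; this
  locates the eigenvectors for \<alpha>\<beta> and for every other eigenvalue.\<close>

lemma R_eq: "R x = (\<alpha> * \<beta>) *s x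
    + (\<beta> * (\<alpha> powi (-2) - \<alpha>) * (h x p / h p p)) *s p
    + ((\<beta> powi (-2) - \<beta>) * (h (special_refl h \<alpha> p x) q / h q q)) *s q"
proof -
  have "R x = ((\<beta> powi (-2) - \<beta>) * (h (special_refl h \<alpha> p x) q / h q q)) *s q
      + \<beta> *s special_refl h \<alpha> p x"
    by (simp add: R_def special_refl_def[of h \<beta> q])
  also have "\<beta> *s special_refl h \<alpha> p x = (\<alpha> * \<beta>) *s x
      + (\<beta> * (\<alpha> powi (-2) - \<alpha>) * (h x p / h p p)) *s p"
    by (simp add: special_refl_def vec_eq_iff algebra_simps)
  finally show ?thesis
    by (simp add: ac_simps)
qed

lemma R_p: "R p = (\<alpha> powi (-2) * \<beta>) *s p
    + (\<alpha> powi (-2) * (\<beta> powi (-2) - \<beta>) * (h p q / h q q)) *s q"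
proof -
  have "special_refl h \<alpha> p p = \<alpha> powi (-2) *s p"
    using nonisotropic by (simp add: special_refl_def vec_eq_iff algebra_simps)
  then have "R p = special_refl h \<beta> q (\<alpha> powi (-2) *s p)"
    by (simp add: R_def)
  then show ?thesis
    by (simp add: special_refl_def vec_eq_iff algebra_simps)
qed

lemma R_q: "R q = ((\<alpha> powi (-2) - \<alpha>) * (h q p / h p p)) *s
      (\<beta> *s p + ((\<beta> powi (-2) - \<beta>) * (h p q / h q q)) *s q)
    + (\<alpha> * \<beta> powi (-2)) *s q"
proof -
  have "special_refl h \<beta> q q = \<beta> powi (-2) *s q"
    using nonisotropic by (simp add: special_refl_def vec_eq_iff algebra_simps)
  moreover have "special_refl h \<beta> q p = \<beta> *s p + ((\<beta> powi (-2) - \<beta>) * (h p q / h q q)) *s q"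
    by (simp add: special_refl_def)
  moreover have "special_refl h \<beta> q (c *s p + d *s q)
      = c *s special_refl h \<beta> q p + d *s special_refl h \<beta> q q" for c d
    using linear_special_refl[of \<beta> q] by (simp add: Vector_Spaces.linear_iff)
  ultimately show ?thesis
    by (simp add: R_def special_refl_def[of h \<alpha> p])
qed

text \<open>Cayley--Hamilton for the restriction of \<open>R\<close> to the plane spanned by \<open>p\<close> and \<open>q\<close>,
  whose trace and determinant are \<open>tr\<close> and \<open>dt\<close>.\<close>

lemma R_R_p: "R (R p) = tr *s R p - dt *s p"
proof -
  have R_R: "R (R p) = (\<alpha> powi (-2) * \<beta>) *s R p
    + (\<alpha> powi (-2) * (\<beta> powi (-2) - \<beta>) * (h p q / h q q)) *s R q"
    by (subst R_p) (simp add: R_add R_scale)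
  have tr: "tr = \<alpha> powi (-2) * \<beta> + \<alpha> * \<beta> powi (-2)
      + (\<alpha> powi (-2) - \<alpha>) * (\<beta> powi (-2) - \<beta>) * ((h p q / h q q) * (h q p / h p p))"
    by (simp add: tr_def mult.commute)
  show ?thesis
    unfolding R_R tr R_q unfolding R_p dt_def vec_eq_iff vector_add_component vector_minus_component
      vector_smult_component
    by (rule allI) algebra
qed

lemma plane_independent:
  assumes "s *s p + t *s q = 0"
  shows "s = 0" "t = 0"
proof -
  have "h (s *s p + t *s q) p = 0" "h (s *s p + t *s q) q = 0"
    using assms by simp_all
  then have *: "s * h p p + t * h q p = 0" "s * h p q + t * h q q = 0"
    by simp_all
  then have "s * (h p p * h q q - h p q * h q p) = 0" "t * (h p p * h q q - h p q * h q p) = 0"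
    by algebra+
  with nondegenerate show "s = 0" "t = 0"
    by auto
qed

lemma plane_eqI: "s = s' \<and> t = t'" if "s *s p + t *s q = s' *s p + t' *s q"
proof -
  have "(s - s') *s p + (t - t') *s q = (s *s p + t *s q) - (s' *s p + t' *s q)"
    by (simp add: vec_eq_iff algebra_simps)
  with that have "(s - s') *s p + (t - t') *s q = 0"
    by simp
  from plane_independent[OF this] show ?thesis
    by simp
qed

lemma plane_nondegenerate:
  assumes "x \<in> proj_line p q" "h x p = 0" "h x q = 0"
  shows "x = 0"
proof -
  obtain s t where x: "x = s *s p + t *s q"
    using assms(1) by (auto simp: proj_line_def span_pair)
  have *: "s * h p p + t * h q p = 0" "s * h p q + t * h q q = 0"
    using assms(2,3) x by simp_all
  then have "s * (h p p * h q q - h p q * h q p) = 0" "t * (h p p * h q q - h p q * h q p) = 0"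
    by algebra+
  with nondegenerate x show ?thesis
    by auto
qed

text \<open>Cramer's rule for the Gram system of \<open>p\<close> and \<open>q\<close>, with
  \<open>D\<close> the Gram determinant.\<close>

lemma plane_projection:
  obtains w u where "x = w + u" "w \<in> proj_line p q" "h u p = 0" "h u q = 0"
proof -
  define D where "D = h p p * h q q - h p q * h q p"
  have D: "D \<noteq> 0"
    using nondegenerate by (simp add: D_def)
  define s where "s = (h x p * h q q - h x q * h q p) / D"
  define t where "t = (h x q * h p p - h x p * h p q) / D"
  have s: "s * D = h x p * h q q - h x q * h q p" and t: "t * D = h x q * h p p - h x p * h p q"
    using D by (simp_all add: s_def t_def)
  have "D * (h x p - (s * h p p + t * h q p)) = D * h x p - (s * D) * h p p - (t * D) * h q p"
    by algebra
  also have "\<dots> = 0"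
    unfolding s t unfolding D_def by algebra
  finally have p: "h x p - (s * h p p + t * h q p) = 0"
    using D by simp
  have "D * (h x q - (s * h p q + t * h q q)) = D * h x q - (s * D) * h p q - (t * D) * h q q"
    by algebra
  also have "\<dots> = 0"
    unfolding s t unfolding D_def by algebra
  finally have q: "h x q - (s * h p q + t * h q q) = 0"
    using D by simp
  show thesis
    by (rule that[of "s *s p + t *s q" "x - (s *s p + t *s q)"])
       (use p q in \<open>auto simp: proj_line_def span_pair\<close>)
qed

text \<open>Nonorthogonality and \<beta>^3 \<noteq> 1 make \<open>R p\<close> independent of
  \<open>p\<close>. Thus \<open>p\<close> is a cyclic vector for \<open>R\<close> on the plane, and
  each root has just one eigenline there.\<close>

lemma R_p_plane:
  obtains s t where "R p = s *s p + t *s q" "t \<noteq> 0"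
  using R_p nonzero nonisotropic nonorthogonal coeff_nonzero[OF nonzero(2) not_cube_root(2)]
  by (metis divide_eq_0_iff mult_eq_0_iff)

lemma plane_cyclic:
  assumes "x \<in> proj_line p q"
  obtains s t where "x = s *s p + t *s R p"
proof -
  obtain a b where x: "x = a *s p + b *s q"
    using assms by (auto simp: proj_line_def span_pair)
  obtain c d where Rp: "R p = c *s p + d *s q" "d \<noteq> 0"
    by (rule R_p_plane)
  have "x = (a - b / d * c) *s p + (b / d) *s R p"
    unfolding x Rp(1) vec_eq_iff using Rp(2) by (simp add: field_simps)
  then show thesis
    by (rule that)
qed

lemma cyclic_independent:
  assumes "s *s p + t *s R p = s' *s p + t' *s R p"
  shows "s = s' \<and> t = t'"
proof -
  obtain c d where Rp: "R p = c *s p + d *s q" "d \<noteq> 0"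
    by (rule R_p_plane)
  have "(s + t * c) *s p + (t * d) *s q = (s' + t' * c) *s p + (t' * d) *s q"
    using assms unfolding Rp(1) by (simp add: vec_eq_iff algebra_simps)
  from plane_eqI[OF this] Rp(2) show ?thesis
    by auto
qed

lemma eigvec_in_plane: "eigvec \<mu> \<in> proj_line p q"
proof -
  have "p \<in> proj_line p q" "q \<in> proj_line p q"
    by (auto simp: proj_line_def intro: vec.span_base)
  then show ?thesis
    unfolding eigvec_def R_p proj_line_def
    by (intro vec.span_diff vec.span_add vec.span_scale)
qed

lemma eigvec_nonzero: "eigvec \<mu> \<noteq> 0"
proof
  assume "eigvec \<mu> = 0"
  then have "(- (tr - \<mu>)) *s p + 1 *s R p = 0 *s p + 0 *s R p"
    by (simp add: eigvec_def vec_eq_iff)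
  from cyclic_independent[OF this] show False
    by simp
qed

lemma R_eigvec: "R (eigvec \<mu>) = \<mu> *s eigvec \<mu>" if "\<mu>\<^sup>2 - tr * \<mu> + dt = 0"
proof -
  show ?thesis
    unfolding eigvec_def R_diff R_scale R_R_p vec_eq_iff vector_minus_component
      vector_smult_component
    using that by (intro allI) algebra
qed

text \<open>By independence of \<open>p\<close> and \<open>q\<close> both coefficients in
  \<open>R_eq\<close> must vanish. The first gives \<open>h x p = 0\<close>; then the first
  reflection only scales \<open>x\<close>, and the second coefficient gives
  \<open>h x q = 0\<close>.\<close>

lemma eigenvector_off_plane:
  "R x = (\<alpha> * \<beta>) *s x \<longleftrightarrow> h x p = 0 \<and> h x q = 0"
proof
  assume "R x = (\<alpha> * \<beta>) *s x"
  then have "(\<beta> * (\<alpha> powi (-2) - \<alpha>) * (h x p / h p p)) *s p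
    + ((\<beta> powi (-2) - \<beta>) * (h (special_refl h \<alpha> p x) q / h q q)) *s q = 0"
    unfolding R_eq[of x] by (simp add: add.assoc)
  note * = plane_independent[OF this]
  from *(1) have xp: "h x p = 0"
    using nonzero nonisotropic coeff_nonzero[OF nonzero(1) not_cube_root(1)] by simp
  moreover from *(2) have "h (special_refl h \<alpha> p x) q = 0"
    using nonisotropic coeff_nonzero[OF nonzero(2) not_cube_root(2)] by simp
  then have "h x q = 0"
    using xp nonzero by (simp add: special_refl_def)
  ultimately show "h x p = 0 \<and> h x q = 0" ..
next
  assume "h x p = 0 \<and> h x q = 0"
  then show "R x = (\<alpha> * \<beta>) *s x"
    unfolding R_eq[of x] by (simp add: special_refl_def)
qed

text \<open>If \<mu> is not \<alpha>\<beta>, then \<open>R_eq\<close> puts \<open>x\<close> into the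
  plane. Comparing coordinates with respect to \<open>p\<close> and \<open>R p\<close> then yields
  the characteristic equation and a multiple of \<open>eigvec \<mu>\<close>.\<close>

lemma eigenvector_cases:
  assumes "x \<noteq> 0" "R x = \<mu> *s x"
  obtains "\<mu> = \<alpha> * \<beta>" "h x p = 0" "h x q = 0"
    | c where "\<mu>\<^sup>2 - tr * \<mu> + dt = 0" "c \<noteq> 0" "x = c *s eigvec \<mu>"
proof (cases "\<mu> = \<alpha> * \<beta>")
  case True
  then show thesis
    using that(1) assms eigenvector_off_plane by blast
next
  case False
  let ?s = "\<beta> * (\<alpha> powi (-2) - \<alpha>) * (h x p / h p p)"
  let ?t = "(\<beta> powi (-2) - \<beta>) * (h (special_refl h \<alpha> p x) q / h q q)"
  have "(\<mu> - \<alpha> * \<beta>) *s x = ?s *s p + ?t *s q"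
    using R_eq[of x] assms(2) by (simp add: vec_eq_iff algebra_simps)
  moreover have "?s *s p + ?t *s q \<in> proj_line p q"
    unfolding proj_line_def span_pair by blast
  ultimately have "(\<mu> - \<alpha> * \<beta>) *s x \<in> proj_line p q"
    by simp
  moreover have "y = (1 / k) *s (k *s y)" if "k \<noteq> 0" for k and y :: V
    using that by simp
  ultimately have "x \<in> proj_line p q"
    unfolding proj_line_def using False by (metis vec.span_scale right_minus_eq)
  then obtain s t where x: "x = s *s p + t *s R p"
    by (rule plane_cyclic)
  have "R x = (- (t * dt)) *s p + (s + t * tr) *s R p"
    unfolding x R_add R_scale R_R_p by (simp add: vec_eq_iff algebra_simps)
  moreover have "\<mu> *s x = (\<mu> * s) *s p + (\<mu> * t) *s R p"
    unfolding x by (simp add: vec_eq_iff algebra_simps)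
  ultimately have st: "- (t * dt) = \<mu> * s" "s + t * tr = \<mu> * t"
    using assms(2) cyclic_independent by metis+
  have s: "s = - (tr - \<mu>) * t"
    using st(2) by algebra
  have "t * (\<mu>\<^sup>2 - tr * \<mu> + dt) = 0"
    using st by algebra
  moreover have "t \<noteq> 0"
    using s x assms(1) by auto
  moreover have "x = t *s eigvec \<mu>"
    unfolding x s eigvec_def by (simp add: vec_eq_iff algebra_simps)
  ultimately show thesis
    using that(2) by simp
qed

text \<open>Otherwise an eigenvector in the plane would be orthogonal to the whole plane. This
  separates \<alpha>\<beta> from the eigenvalues on the plane.\<close>

lemma not_root: "(\<alpha> * \<beta>)\<^sup>2 - tr * (\<alpha> * \<beta>) + dt \<noteq> 0"
proof
  assume "(\<alpha> * \<beta>)\<^sup>2 - tr * (\<alpha> * \<beta>) + dt = 0"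
  then have "R (eigvec (\<alpha> * \<beta>)) = (\<alpha> * \<beta>) *s eigvec (\<alpha> * \<beta>)"
    by (rule R_eigvec)
  then show False
    using eigenvector_off_plane eigvec_in_plane plane_nondegenerate eigvec_nonzero by blast
qed


section \<open>Orthogonality and isotropy of eigenvectors, and the spectrum of
  \<open>R\<close>\<close>

lemma isotropic_eigenvector:
  assumes "R x = \<mu> *s x" "cmod \<mu> \<noteq> 1"
  shows "h x x = 0"
proof -
  have "h x x = \<mu> * cnj \<mu> * h x x"
    using R_isometry[of x x] unfolding assms(1) form_scale_left form_scale_right
    by (simp only: ac_simps)
  then have "h x x = of_real ((cmod \<mu>)\<^sup>2) * h x x"
    by (simp only: complex_norm_square)
  moreover have "(cmod \<mu>)\<^sup>2 \<noteq> 1"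
    using assms(2) by (metis norm_ge_zero power2_eq_1_iff neg_0_le_iff_le not_one_le_zero)
  ultimately show ?thesis
    by (metis mult_cancel_right1 of_real_eq_1_iff)
qed

lemma orthogonal_eigenvectors:
  assumes "R x = \<mu> *s x" "R y = \<nu> *s y" "\<mu> \<noteq> \<nu>" "cmod \<nu> = 1"
  shows "h x y = 0"
proof -
  have "h x y = \<mu> * cnj \<nu> * h x y"
    using R_isometry[of x y] unfolding assms(1,2) form_scale_left form_scale_right
    by (simp only: ac_simps)
  moreover have "\<mu> * cnj \<nu> \<noteq> 1"
  proof
    assume "\<mu> * cnj \<nu> = 1"
    then have "\<mu> * (\<nu> * cnj \<nu>) = \<nu>"
      by (simp add: ac_simps)
    moreover have "\<nu> * cnj \<nu> = 1"
      using assms(4) by (metis complex_norm_square of_real_1 one_power2)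
    ultimately show False
      using assms(3) by simp
  qed
  ultimately show ?thesis
    by (metis mult_cancel_right1)
qed

lemma orthogonal_plane:
  assumes "h u p = 0" "h u q = 0" "x \<in> proj_line p q"
  shows "h u x = 0"
  using assms by (auto simp: proj_line_def span_pair)

lemma off_plane_vector:
  obtains u where "u \<noteq> 0" "h u p = 0" "h u q = 0"
proof -
  have "proj_line p q \<noteq> UNIV"
  proof
    assume "proj_line p q = UNIV"
    then have "vec.dim (UNIV :: V set) \<le> card {p, q}"
      by (intro vec.dim_le_card) (simp_all add: proj_line_def)
    moreover have "card {p, q} \<le> 2"
      by (simp add: card_insert_if)
    ultimately show False
      by (simp add: vec.dim_UNIV card_cart_basis)
  qed
  then obtain x where x: "x \<notin> proj_line p q"
    by blast
  obtain w u where "x = w + u" "w \<in> proj_line p q" "h u p = 0" "h u q = 0"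
    by (rule plane_projection)
  with x show thesis
    by (intro that[of u]) auto
qed

text \<open>A vector orthogonal to the plane would fix the scalar as \<alpha>\<beta>, and then
  \<open>p\<close> would be orthogonal to itself.\<close>

lemma not_scalar: "\<not> scalar_map R"
proof
  assume "scalar_map R"
  then obtain c where c: "R x = c *s x" for x
    unfolding scalar_map_def by metis
  obtain u where u: "u \<noteq> 0" "h u p = 0" "h u q = 0"
    by (rule off_plane_vector)
  have "R u = (\<alpha> * \<beta>) *s u"
    using u eigenvector_off_plane by blast
  with c[of u] u have "c = \<alpha> * \<beta>"
    by simp
  then have "h p p = 0"
    using c[of p] eigenvector_off_plane[of p] by simp
  with nonisotropic show False
    by simp
qed

lemma root_iff:
  assumes "tr = \<mu> + \<nu>" "dt = \<mu> * \<nu>"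
  shows "x\<^sup>2 - tr * x + dt = 0 \<longleftrightarrow> x = \<mu> \<or> x = \<nu>"
proof -
  have "x\<^sup>2 - tr * x + dt = (x - \<mu>) * (x - \<nu>)"
    unfolding assms by algebra
  then show ?thesis
    by simp
qed

lemma eigenvalues_R: "eigenvalues R = insert (\<alpha> * \<beta>) {\<mu>. \<mu>\<^sup>2 - tr * \<mu> + dt = 0}"
proof -
  obtain u where "u \<noteq> 0" "h u p = 0" "h u q = 0"
    by (rule off_plane_vector)
  then have "\<alpha> * \<beta> \<in> eigenvalues R"
    unfolding eigenvalues_def using eigenvector_off_plane by blast
  moreover have "\<mu> \<in> eigenvalues R" if "\<mu>\<^sup>2 - tr * \<mu> + dt = 0" for \<mu>
    unfolding eigenvalues_def using R_eigvec[OF that] eigvec_nonzero by blast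
  moreover have "\<mu> = \<alpha> * \<beta> \<or> \<mu>\<^sup>2 - tr * \<mu> + dt = 0" if "\<mu> \<in> eigenvalues R" for \<mu>
    using that unfolding eigenvalues_def by (auto elim: eigenvector_cases)
  ultimately show ?thesis
    by blast
qed

lemma card_eigenvalues:
  assumes "tr = \<mu> + \<nu>" "dt = \<mu> * \<nu>" "\<mu> \<noteq> \<nu>"
  shows "card (eigenvalues R) = 3"
proof -
  have "eigenvalues R = {\<alpha> * \<beta>, \<mu>, \<nu>}"
    unfolding eigenvalues_R root_iff[OF assms(1,2)] by auto
  moreover have "\<alpha> * \<beta> \<noteq> \<mu>" "\<alpha> * \<beta> \<noteq> \<nu>"
    using not_root root_iff[OF assms(1,2)] by metis+
  ultimately show ?thesis
    using assms(3) by simp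
qed

section \<open>From the eigenvalues on the plane to the type of \<open>R\<close>\<close>

lemma fixed_pointI: "v \<noteq> 0 \<Longrightarrow> R v = \<mu> *s v \<Longrightarrow> vec.span {v} \<in> fixed_points_of_sign h R (sigma h v)"
  unfolding fixed_points_of_sign_def by blast

lemma regular_ellipticI:
  assumes "tr = \<mu> + \<nu>" "dt = \<mu> * \<nu>" "\<mu> \<noteq> \<nu>" "v \<noteq> 0" "R v = k *s v" "Re (h v v) < 0"
  shows "regular_elliptic h R"
proof -
  have "sigma h v = -1"
    using assms(6) by (simp add: sigma_def)
  then have "fixed_points_of_sign h R (-1) \<noteq> {}"
    using fixed_pointI[OF assms(4,5)] by auto
  then show ?thesis
    using R_SU not_scalar card_eigenvalues[OF assms(1-3)]
    by (simp add: regular_elliptic_def elliptic_def)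
qed

text \<open>Splitting a negative vector along the plane leaves all the negativity to the orthogonal
  part, which is an eigenvector for \<alpha>\<beta>.\<close>

lemma regular_elliptic_spherical:
  assumes "tr = \<mu> + \<nu>" "dt = \<mu> * \<nu>" "\<mu> \<noteq> \<nu>"
    and pos: "\<And>x. x \<in> proj_line p q \<Longrightarrow> Re (h x x) \<ge> 0"
  shows "regular_elliptic h R"
proof -
  obtain n where n: "Re (h n n) < 0"
    by (rule negative_vector)
  obtain w u where nwu: "n = w + u" and w: "w \<in> proj_line p q" and u: "h u p = 0" "h u q = 0"
    by (rule plane_projection)
  have "h u w = 0" "h w u = 0"
    using orthogonal_plane[OF u w] form_eq_0_commute by blast+
  then have "h n n = h w w + h u u"
    by (simp add: nwu)
  then have neg: "Re (h u u) < 0"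
    using n pos[OF w] by simp
  moreover from neg have "u \<noteq> 0"
    by auto
  moreover have "R u = (\<alpha> * \<beta>) *s u"
    using u eigenvector_off_plane by blast
  ultimately show ?thesis
    using assms(1-3) regular_ellipticI by blast
qed

text \<open>The two plane eigenvectors are orthogonal, and \<open>n\<close> is a combination of
  them; since \<open>n\<close> is negative, so is one of them.\<close>

lemma regular_elliptic_hyperbolic:
  assumes "tr = \<mu> + \<nu>" "dt = \<mu> * \<nu>" "\<mu> \<noteq> \<nu>" "cmod \<mu> = 1" "cmod \<nu> = 1"
    and n: "n \<in> proj_line p q" "Re (h n n) < 0"
  shows "regular_elliptic h R"
proof -
  let ?v = "eigvec \<mu>" and ?w = "eigvec \<nu>"
  have v: "R ?v = \<mu> *s ?v" and w: "R ?w = \<nu> *s ?w"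
    using R_eigvec root_iff[OF assms(1,2)] by blast+
  have vw: "h ?v ?w = 0" "h ?w ?v = 0"
    using orthogonal_eigenvectors[OF v w] orthogonal_eigenvectors[OF w v] assms by auto
  obtain s t where st: "n = s *s p + t *s R p"
    using n(1) by (rule plane_cyclic)
  \<comment> \<open>Solves for the coefficients of \<open>n\<close> in the eigenvectors: those of
    \<open>R p\<close> must add up to \<open>t\<close>, and those of \<open>p\<close> then determine
    \<open>b\<close>.\<close>
  define b where "b = (s + (tr - \<mu>) * t) / (\<mu> - \<nu>)"
  have b: "b * (\<mu> - \<nu>) = s + (tr - \<mu>) * t"
    using assms(3) by (simp add: b_def)
  have "n = (t + b) *s ?v + (- b) *s ?w"
    unfolding st eigvec_def vec_eq_iff vector_add_component vector_minus_component
      vector_smult_component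
    using b by (intro allI) algebra
  then have "h n n = of_real ((cmod (t + b))\<^sup>2) * h ?v ?v + of_real ((cmod b)\<^sup>2) * h ?w ?w"
    using vw unfolding complex_norm_square
    by (simp only: form_add_left form_add_right form_scale_left form_scale_right) (simp add: algebra_simps)
  then have "Re (h n n) = (cmod (t + b))\<^sup>2 * Re (h ?v ?v) + (cmod b)\<^sup>2 * Re (h ?w ?w)"
    by (simp del: of_real_power)
  with n(2) have "Re (h ?v ?v) < 0 \<or> Re (h ?w ?w) < 0"
    by (smt (verit) mult_nonneg_nonneg zero_le_power2)
  then show ?thesis
    using regular_ellipticI[OF assms(1-3)] eigvec_nonzero v w by blast
qed

text \<open>Shared by the loxodromic and the parabolic case. An eigenvector off the plane is
  orthogonal to the negative vector \<open>n\<close>, hence positive, so only the lines of the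
  isotropic \<open>eigvec \<mu>\<close> can count.\<close>

lemma fixed_points_isotropic:
  assumes iso: "\<And>\<mu>. \<mu>\<^sup>2 - tr * \<mu> + dt = 0 \<Longrightarrow> h (eigvec \<mu>) (eigvec \<mu>) = 0"
    and n: "n \<in> proj_line p q" "Re (h n n) < 0"
  shows "fixed_points_of_sign h R (-1) = {}"
    and "fixed_points_of_sign h R 0 = (\<lambda>\<mu>. vec.span {eigvec \<mu>}) ` {\<mu>. \<mu>\<^sup>2 - tr * \<mu> + dt = 0}"
proof -
  have *: "sigma h x = 1 \<or> sigma h x = 0 \<and>
      (\<exists>\<mu>. \<mu>\<^sup>2 - tr * \<mu> + dt = 0 \<and> vec.span {x} = vec.span {eigvec \<mu>})"
    if x: "x \<noteq> 0" "R x = \<mu> *s x" for x \<mu>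
    using x
  proof (cases rule: eigenvector_cases)
    case 1
    then have "Re (h x x) > 0"
      using orthogonal_plane n x(1) orthogonal_negative by blast
    then show ?thesis
      by (simp add: sigma_def)
  next
    case (2 c)
    then have "h x x = 0"
      using iso by simp
    moreover have "vec.span {x} = vec.span {eigvec \<mu>}"
      using 2 by (simp add: span_singleton_scale)
    ultimately show ?thesis
      using 2 by (auto simp: sigma_def)
  qed
  show "fixed_points_of_sign h R (-1) = {}"
    unfolding fixed_points_of_sign_def using * by fastforce
  show "fixed_points_of_sign h R 0 = (\<lambda>\<mu>. vec.span {eigvec \<mu>}) ` {\<mu>. \<mu>\<^sup>2 - tr * \<mu> + dt = 0}"
  proof
    show "fixed_points_of_sign h R 0 \<subseteq> (\<lambda>\<mu>. vec.span {eigvec \<mu>}) ` {\<mu>. \<mu>\<^sup>2 - tr * \<mu> + dt = 0}"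
    proof
      fix X
      assume "X \<in> fixed_points_of_sign h R 0"
      then obtain x \<mu> where "X = vec.span {x}" "x \<noteq> 0" "R x = \<mu> *s x" "sigma h x = 0"
        unfolding fixed_points_of_sign_def by blast
      with *[of x \<mu>] show "X \<in> (\<lambda>\<mu>. vec.span {eigvec \<mu>}) ` {\<mu>. \<mu>\<^sup>2 - tr * \<mu> + dt = 0}"
        by auto
    qed
    have "sigma h (eigvec \<mu>) = 0" if "\<mu>\<^sup>2 - tr * \<mu> + dt = 0" for \<mu>
      using iso[OF that] by (simp add: sigma_def)
    then show "(\<lambda>\<mu>. vec.span {eigvec \<mu>}) ` {\<mu>. \<mu>\<^sup>2 - tr * \<mu> + dt = 0} \<subseteq> fixed_points_of_sign h R 0"
      using fixed_pointI[OF eigvec_nonzero R_eigvec] by fastforce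
  qed
qed

lemma loxodromicI:
  assumes "tr = \<mu> + \<nu>" "dt = \<mu> * \<nu>" "\<mu> \<noteq> \<nu>" "cmod \<mu> \<noteq> 1" "cmod \<nu> \<noteq> 1"
    and n: "n \<in> proj_line p q" "Re (h n n) < 0"
  shows "loxodromic h R"
proof -
  note root = root_iff[OF assms(1,2)]
  have iso: "h (eigvec x) (eigvec x) = 0" if "x\<^sup>2 - tr * x + dt = 0" for x
    using R_eigvec[OF that] isotropic_eigenvector[of "eigvec x" x] that root assms(4,5) by auto
  \<comment> \<open>The coefficient of \<open>R p\<close> in every \<open>eigvec\<close> is 1, so
    proportional eigenvectors are equal and their roots coincide.\<close>
  have "vec.span {eigvec \<mu>} \<noteq> vec.span {eigvec \<nu>}"
  proof
    assume "vec.span {eigvec \<mu>} = vec.span {eigvec \<nu>}"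
    then have "eigvec \<mu> \<in> vec.span {eigvec \<nu>}"
      by (metis vec.span_base singletonI)
    then obtain k where "eigvec \<mu> = k *s eigvec \<nu>"
      by (auto simp: vec.span_singleton)
    then have "(- (tr - \<mu>)) *s p + 1 *s R p = (- (k * (tr - \<nu>))) *s p + k *s R p"
      by (simp add: eigvec_def vec_eq_iff algebra_simps)
    from cyclic_independent[OF this] assms(3) show False
      by auto
  qed
  moreover have "{x. x\<^sup>2 - tr * x + dt = 0} = {\<mu>, \<nu>}"
    using root by auto
  ultimately have "card (fixed_points_of_sign h R 0) = 2"
    using fixed_points_isotropic(2)[OF iso n] by simp
  then show ?thesis
    using fixed_points_isotropic(1)[OF iso n] R_SU not_scalar by (simp add: loxodromic_def)
qed

lemma unipotent_eigenvalue:
  assumes "unipotent (\<lambda>x. \<omega> *s R x)" "R v = \<mu> *s v" "v \<noteq> 0"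
  shows "\<omega> * \<mu> = 1"
proof -
  obtain n where n: "(\<lambda>x. \<omega> *s R x - x) ^^ n = (\<lambda>x. 0)"
    using assms(1) unfolding unipotent_def by blast
  have "((\<lambda>x. \<omega> *s R x - x) ^^ k) v = (\<omega> * \<mu> - 1) ^ k *s v" for k
  proof (induction k)
    case (Suc k)
    then show ?case
      unfolding funpow.simps o_apply Suc R_scale assms(2)
      by (simp add: vec_eq_iff algebra_simps)
  qed simp
  from this[of n] n have "(\<omega> * \<mu> - 1) ^ n *s v = 0"
    by simp
  with assms(3) show ?thesis
    by simp
qed

lemma ellipto_parabolicI:
  assumes "tr = 2 * \<mu>" "dt = \<mu>\<^sup>2"
    and n: "n \<in> proj_line p q" "Re (h n n) < 0"
  shows "ellipto_parabolic h R"
proof -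
  have tr: "tr = \<mu> + \<mu>" and dt: "dt = \<mu> * \<mu>"
    using assms by (simp_all add: power2_eq_square)
  note root = root_iff[OF tr dt]
  let ?v = "eigvec \<mu>"
  have v: "R ?v = \<mu> *s ?v"
    using R_eigvec root by blast
  have \<mu>: "\<mu> \<noteq> 0"
    using dt dt_eq by auto
  \<comment> \<open>\<open>p\<close> and \<open>eigvec \<mu>\<close> form a Jordan chain, which forces the eigenvector to be isotropic.\<close>
  have iso: "h (eigvec x) (eigvec x) = 0" if "x\<^sup>2 - tr * x + dt = 0" for x
  proof (cases "cmod \<mu> = 1")
    case True
    then have unit: "\<mu> * cnj \<mu> = 1"
      by (metis complex_norm_square of_real_1 one_power2)
    have Rp: "R p = ?v + \<mu> *s p"
      by (simp add: eigvec_def tr)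
    have "h p ?v = h (R p) (R ?v)"
      by (simp add: R_isometry)
    also have "\<dots> = cnj \<mu> * h ?v ?v + (\<mu> * cnj \<mu>) * h p ?v"
      unfolding v Rp by (simp add: algebra_simps)
    finally have "h ?v ?v = 0"
      using unit \<mu> by simp
    then show ?thesis
      using that root by simp
  next
    case False
    then show ?thesis
      using isotropic_eigenvector[OF v] that root by auto
  qed
  have "{x. x\<^sup>2 - tr * x + dt = 0} = {\<mu>}"
    using root by auto
  then have "card (fixed_points_of_sign h R 0) = 1"
    using fixed_points_isotropic(2)[OF iso n] by simp
  then have "parabolic h R"
    using fixed_points_isotropic(1)[OF iso n] R_SU not_scalar by (simp add: parabolic_def)
  \<comment> \<open>Unipotence would require both \<alpha>\<beta> and \<mu> to become 1 after
    multiplication by \<omega>, against \<open>not_root\<close>.\<close>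
  moreover have "\<not> unipotent (\<lambda>x. \<omega> *s R x)" for \<omega>
  proof
    assume uni: "unipotent (\<lambda>x. \<omega> *s R x)"
    obtain u where "u \<noteq> 0" "h u p = 0" "h u q = 0"
      by (rule off_plane_vector)
    then have "\<omega> * (\<alpha> * \<beta>) = 1"
      using unipotent_eigenvalue[OF uni] eigenvector_off_plane by blast
    moreover have "\<omega> * \<mu> = 1"
      using unipotent_eigenvalue[OF uni v eigvec_nonzero] .
    ultimately have "\<alpha> * \<beta> = \<mu>"
      by (metis mult_cancel_left mult_zero_left zero_neq_one)
    then show False
      using not_root root by blast
  qed
  ultimately show ?thesis
    by (simp add: ellipto_parabolic_def)
qed


section \<open>The normalized trace as an affine function of \<open>ta\<close>\<close>

text \<open>The midpoint of the interval with endpoints \<kappa> - S/2 and \<kappa> + S/2;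
  \<open>k\<^sub>1\<close> is one of these endpoints, chosen by the product of the signs.\<close>

definition \<kappa> :: real where
  "\<kappa> = (1 + 4 * chi \<alpha> * chi \<beta>) / 2"

definition S :: real where
  "S = sqrt ((1 + 4 * (chi \<alpha>)\<^sup>2) * (1 + 4 * (chi \<beta>)\<^sup>2))"

lemma S_pos: "S > 0"
  by (simp add: S_def add_pos_nonneg)

text \<open>The unit interval lies between the two endpoints. Indeed S^2 exceeds the squares of 1 -
  4 \<open>chi \<alpha>\<close> \<open>chi \<beta>\<close> and 1 + 4 \<open>chi \<alpha>\<close>
  \<open>chi \<beta>\<close> by four times the square of the sum and of the difference of the two
  \<open>chi\<close> values.\<close>

lemma S_bounds: "\<kappa> + S / 2 \<ge> 1" "\<kappa> - S / 2 \<le> 0"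
proof -
  have "\<bar>1 - 4 * chi \<alpha> * chi \<beta>\<bar> \<le> S" "\<bar>1 + 4 * chi \<alpha> * chi \<beta>\<bar> \<le> S"
    unfolding S_def
    using zero_le_power2[of "chi \<alpha> + chi \<beta>"] zero_le_power2[of "chi \<alpha> - chi \<beta>"]
    by (auto intro!: real_le_rsqrt simp: power2_eq_square algebra_simps)
  then show "\<kappa> + S / 2 \<ge> 1" "\<kappa> - S / 2 \<le> 0"
    by (simp_all add: \<kappa>_def abs_le_iff field_simps)
qed

text \<open>After factoring out \<open>?a * ?b\<close>, the terms without \<open>ta\<close> become x
  + y + 2xy in the quotients of \<open>quotient_chi\<close>; their real parts -1/2 make the
  imaginary parts cancel.\<close>

lemma tr_eq: "tr = (\<alpha> powi (-2) - \<alpha>) * (\<beta> powi (-2) - \<beta>) * of_real (ta h p q - \<kappa>)"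
proof -
  let ?a = "\<alpha> powi (-2) - \<alpha>" and ?b = "\<beta> powi (-2) - \<beta>"
  let ?x = "\<alpha> / ?a" and ?y = "\<beta> / ?b"
  have ne: "?a \<noteq> 0" "?b \<noteq> 0"
    using coeff_nonzero nonzero not_cube_root by blast+
  have "tr = ?a * ?b * of_real (ta h p q) + (?a + \<alpha>) * \<beta> + \<alpha> * (?b + \<beta>)"
    by (simp add: tr_def of_real_ta[OF hermitian])
  also have "\<dots> = ?a * ?b * (of_real (ta h p q) + (?x + ?y + 2 * ?x * ?y))"
  proof -
    have "\<alpha> = ?a * ?x" "\<beta> = ?b * ?y"
      using ne by simp_all
    then show ?thesis
      by algebra
  qed
  also have "?x + ?y + 2 * ?x * ?y = - of_real \<kappa>"
    unfolding quotient_chi(1)[OF unit(1) not_cube_root(1)] quotient_chi(1)[OF unit(2) not_cube_root(2)]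
    by (simp add: complex_eq_iff \<kappa>_def field_simps)
  finally show ?thesis
    by (simp add: algebra_simps)
qed

text \<open>Dividing \<open>R\<close> on the plane by a square root of its determinant makes the trace real,
  namely \<open>\<plusminus>\<rho>\<close>.\<close>

definition \<rho> :: real where
  "\<rho> = 4 * (ta h p q - \<kappa>) / S"

lemma abs_\<rho>:
  "\<bar>\<rho>\<bar> < 2 \<longleftrightarrow> \<bar>ta h p q - \<kappa>\<bar> < S / 2"
  "\<bar>\<rho>\<bar> = 2 \<longleftrightarrow> \<bar>ta h p q - \<kappa>\<bar> = S / 2"
  "\<bar>\<rho>\<bar> > 2 \<longleftrightarrow> \<bar>ta h p q - \<kappa>\<bar> > S / 2"
proof -
  have \<rho>: "\<bar>\<rho>\<bar> = 4 * \<bar>ta h p q - \<kappa>\<bar> / S"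
    unfolding \<rho>_def abs_divide abs_mult using S_pos by simp
  then show
    "\<bar>\<rho>\<bar> < 2 \<longleftrightarrow> \<bar>ta h p q - \<kappa>\<bar> < S / 2"
    "\<bar>\<rho>\<bar> = 2 \<longleftrightarrow> \<bar>ta h p q - \<kappa>\<bar> = S / 2"
    "\<bar>\<rho>\<bar> > 2 \<longleftrightarrow> \<bar>ta h p q - \<kappa>\<bar> > S / 2"
    unfolding \<rho> using S_pos by (simp_all add: divide_less_eq less_divide_eq divide_eq_eq, linarith+)
qed

text \<open>Multiplying the second equation of \<open>quotient_chi\<close> for \<alpha> and for
  \<beta> gives 16, and \<open>dt_eq\<close> trades the factor \<alpha>\<beta> for
  \<open>dt\<close>.\<close>

lemma tr_square: "tr\<^sup>2 = of_real ((\<rho>)\<^sup>2) * dt"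
proof -
  let ?a = "\<alpha> powi (-2) - \<alpha>" and ?b = "\<beta> powi (-2) - \<beta>"
  let ?A = "complex_of_real (1 + 4 * (chi \<alpha>)\<^sup>2)" and ?B = "complex_of_real (1 + 4 * (chi \<beta>)\<^sup>2)"
  have "S\<^sup>2 = (1 + 4 * (chi \<alpha>)\<^sup>2) * (1 + 4 * (chi \<beta>)\<^sup>2)"
    by (simp add: S_def)
  then have S: "of_real (S\<^sup>2) = ?A * ?B"
    by (simp only: of_real_mult)
  have "of_real (S\<^sup>2) * (?a * ?b)\<^sup>2 = (?A * (\<alpha> * ?a\<^sup>2)) * (?B * (\<beta> * ?b\<^sup>2)) * dt"
    unfolding S using dt_eq by algebra
  also have "\<dots> = 16 * dt"
    using quotient_chi(2)[OF unit(1) not_cube_root(1)] quotient_chi(2)[OF unit(2) not_cube_root(2)]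
    by simp
  finally have "(?a * ?b)\<^sup>2 = 16 * dt / of_real (S\<^sup>2)"
    using S_pos by (simp add: field_simps)
  then have "tr\<^sup>2 = 16 * dt / of_real (S\<^sup>2) * (of_real (ta h p q - \<kappa>))\<^sup>2"
    unfolding tr_eq power_mult_distrib[of "?a * ?b"] by (rule arg_cong)
  also have "\<dots> = of_real (\<rho>\<^sup>2) * dt"
    unfolding \<rho>_def power_divide power_mult_distrib of_real_divide of_real_mult of_real_power by simp
  finally show ?thesis .
qed

lemma trace_normalized:
  obtains \<delta> where "\<delta>\<^sup>2 = dt" "cmod \<delta> = 1" "tr = \<delta> * of_real \<rho>"
proof -
  have "cmod dt * cmod (\<alpha> * \<beta>) = 1"
    using dt_eq by (metis norm_mult norm_one)
  then have "(cmod (csqrt dt))\<^sup>2 = 1"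
    using unit by (simp add: norm_mult flip: norm_power)
  then have norm: "cmod (csqrt dt) = 1"
    by (metis norm_ge_zero power2_eq_1_iff neg_0_le_iff_le not_one_le_zero)
  have "tr\<^sup>2 = (csqrt dt * of_real \<rho>)\<^sup>2"
    unfolding tr_square by (simp add: power_mult_distrib mult.commute)
  \<comment> \<open>The sign ambiguity is absorbed into the choice of the square root.\<close>
  then have "tr = csqrt dt * of_real \<rho> \<or> tr = - csqrt dt * of_real \<rho>"
    by (simp add: power2_eq_iff)
  then show thesis
    using that[of "csqrt dt"] that[of "- csqrt dt"] norm by auto
qed

lemma roots_unit:
  assumes "\<bar>\<rho>\<bar> < 2"
  obtains \<mu> \<nu> where "tr = \<mu> + \<nu>" "dt = \<mu> * \<nu>" "\<mu> \<noteq> \<nu>" "cmod \<mu> = 1" "cmod \<nu> = 1"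
proof -
  obtain \<delta> where \<delta>: "\<delta>\<^sup>2 = dt" "cmod \<delta> = 1" "tr = \<delta> * of_real \<rho>"
    by (rule trace_normalized)
  have r: "\<rho>\<^sup>2 < 4"
    using assms abs_square_less_1[of "\<rho> / 2"] by (simp add: power_divide)
  \<comment> \<open>A root of x^2 - \<rho> x + 1; its conjugate is the other root, and \<delta>
    scales both back to the eigenvalues of \<open>R\<close>.\<close>
  define m where "m = Complex (\<rho> / 2) (sqrt (4 - \<rho>\<^sup>2) / 2)"
  have "(cmod m)\<^sup>2 = 1"
    using r by (simp add: m_def cmod_power2 power_divide diff_divide_distrib)
  then have norm: "cmod m = 1"
    by (metis norm_ge_zero power2_eq_1_iff neg_0_le_iff_le not_one_le_zero)
  then have "m * cnj m = 1"
    by (metis complex_norm_square of_real_1 one_power2)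
  moreover have "m + cnj m = of_real \<rho>"
    by (simp add: m_def complex_eq_iff)
  moreover have "m \<noteq> cnj m"
    using r by (simp add: m_def complex_eq_iff)
  moreover have "\<delta> \<noteq> 0"
    using \<delta>(2) by auto
  ultimately show thesis
    using \<delta> norm
    by (intro that[of "\<delta> * m" "\<delta> * cnj m"])
       (auto simp: norm_mult power2_eq_square ac_simps simp flip: distrib_left)
qed

lemma roots_nonunit:
  assumes "\<bar>\<rho>\<bar> > 2"
  obtains \<mu> \<nu> where "tr = \<mu> + \<nu>" "dt = \<mu> * \<nu>" "\<mu> \<noteq> \<nu>" "cmod \<mu> \<noteq> 1" "cmod \<nu> \<noteq> 1"
proof -
  obtain \<delta> where \<delta>: "\<delta>\<^sup>2 = dt" "cmod \<delta> = 1" "tr = \<delta> * of_real \<rho>"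
    by (rule trace_normalized)
  have r: "\<rho>\<^sup>2 > 4"
    using assms abs_square_le_1[of "\<rho> / 2"] by (simp add: power_divide)
  define m where "m = (\<rho> + sqrt (\<rho>\<^sup>2 - 4)) / 2"
  define m' where "m' = (\<rho> - sqrt (\<rho>\<^sup>2 - 4)) / 2"
  have mm: "m * m' = 1"
    using r by (simp add: m_def m'_def field_simps flip: power2_eq_square)
  have sum: "m + m' = \<rho>"
    by (simp add: m_def m'_def field_simps)
  have ne: "m \<noteq> m'"
    using r by (simp add: m_def m'_def)
  \<comment> \<open>Real numbers with product 1 and one of modulus 1 would be equal.\<close>
  have abs: "\<bar>m\<bar> \<noteq> 1" "\<bar>m'\<bar> \<noteq> 1"
    using mm ne by (auto simp: abs_if split: if_splits)
  have "\<delta> * of_real m * (\<delta> * of_real m') = \<delta>\<^sup>2 * of_real (m * m')"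
    by (simp add: power2_eq_square ac_simps)
  moreover have "\<delta> * of_real m + \<delta> * of_real m' = \<delta> * of_real (m + m')"
    by (simp add: distrib_left)
  moreover have "\<delta> \<noteq> 0"
    using \<delta>(2) by auto
  ultimately show thesis
    using \<delta> mm sum ne abs
    by (intro that[of "\<delta> * of_real m" "\<delta> * of_real m'"]) (auto simp: norm_mult)
qed

lemma root_double:
  assumes "\<bar>\<rho>\<bar> = 2"
  obtains \<mu> where "tr = 2 * \<mu>" "dt = \<mu>\<^sup>2"
proof -
  obtain \<delta> where \<delta>: "\<delta>\<^sup>2 = dt" "cmod \<delta> = 1" "tr = \<delta> * of_real \<rho>"
    by (rule trace_normalized)
  have "\<rho> = 2 \<or> \<rho> = -2"
    using assms by auto
  then show thesis
    using \<delta> that[of \<delta>] that[of "- \<delta>"] by auto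
qed

end

section \<open>Position of \<open>ta\<close> relative to \<open>k\<^sub>1\<close> and the resulting
  trichotomy\<close>

theorem corollary5p10:
  fixes h :: form and \<alpha>\<^sub>1 \<alpha>\<^sub>2 :: complex and p\<^sub>1 p\<^sub>2 :: V
  defines "L \<equiv> proj_line p\<^sub>1 p\<^sub>2"
    and "\<sigma>\<^sub>1 \<equiv> sigma h p\<^sub>1" and "\<sigma>\<^sub>2 \<equiv> sigma h p\<^sub>2"
    and "\<chi>\<^sub>1 \<equiv> chi \<alpha>\<^sub>1" and "\<chi>\<^sub>2 \<equiv> chi \<alpha>\<^sub>2"
  defines "k\<^sub>1 \<equiv> (1 + 4 * \<chi>\<^sub>1 * \<chi>\<^sub>2 + \<sigma>\<^sub>1 * \<sigma>\<^sub>2 * sqrt ((1 + 4 * \<chi>\<^sub>1\<^sup>2) * (1 + 4 * \<chi>\<^sub>2\<^sup>2))) / 2"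
    and "R \<equiv> special_refl h \<alpha>\<^sub>2 p\<^sub>2 \<circ> special_refl h \<alpha>\<^sub>1 p\<^sub>1"
  assumes "hermitian_form h" and "has_signature h UNIV [1, 1, -1]"
    and "\<alpha>\<^sub>1 \<in> sphere 0 1 - Omega" and "\<alpha>\<^sub>2 \<in> sphere 0 1 - Omega"
    and "sigma h p\<^sub>1 \<noteq> 0" and "sigma h p\<^sub>2 \<noteq> 0"
    and "vec.span {p\<^sub>1} \<noteq> vec.span {p\<^sub>2}"
    and "h p\<^sub>1 p\<^sub>2 \<noteq> 0"
    and "\<not> euclidean_line h L"
  shows "(regular_elliptic h R \<longleftrightarrow>
            (0 < ta h p\<^sub>1 p\<^sub>2 \<and> ta h p\<^sub>1 p\<^sub>2 < 1) \<or>
            (hyperbolic_line h L \<and> \<sigma>\<^sub>1 * \<sigma>\<^sub>2 * ta h p\<^sub>1 p\<^sub>2 < \<sigma>\<^sub>1 * \<sigma>\<^sub>2 * k\<^sub>1)) \<and>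
         (ellipto_parabolic h R \<longleftrightarrow> hyperbolic_line h L \<and> ta h p\<^sub>1 p\<^sub>2 = k\<^sub>1) \<and>
         (loxodromic h R \<longleftrightarrow>
            hyperbolic_line h L \<and> \<sigma>\<^sub>1 * \<sigma>\<^sub>2 * ta h p\<^sub>1 p\<^sub>2 > \<sigma>\<^sub>1 * \<sigma>\<^sub>2 * k\<^sub>1)"
proof -
  interpret lorentzian h
    using assms by unfold_locales
  have re: "Re (h p\<^sub>1 p\<^sub>1) \<noteq> 0" "Re (h p\<^sub>2 p\<^sub>2) \<noteq> 0"
    using \<open>sigma h p\<^sub>1 \<noteq> 0\<close> \<open>sigma h p\<^sub>2 \<noteq> 0\<close> by (auto simp: sigma_def)
  then have nonisotropic: "h p\<^sub>1 p\<^sub>1 \<noteq> 0" "h p\<^sub>2 p\<^sub>2 \<noteq> 0"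
    by auto
  let ?t = "ta h p\<^sub>1 p\<^sub>2"
  have ta1: "?t \<noteq> 1"
    using ta_neq_1[OF re] assms by simp
  have "h p\<^sub>1 p\<^sub>1 * h p\<^sub>2 p\<^sub>2 \<noteq> h p\<^sub>1 p\<^sub>2 * h p\<^sub>2 p\<^sub>1"
  proof
    assume "h p\<^sub>1 p\<^sub>1 * h p\<^sub>2 p\<^sub>2 = h p\<^sub>1 p\<^sub>2 * h p\<^sub>2 p\<^sub>1"
    then have "?t = 1"
      using nonisotropic unfolding ta_def by (metis divide_self mult_eq_0_iff one_complex.sel(1))
    with ta1 show False ..
  qed
  then interpret P: reflection_pair h \<alpha>\<^sub>1 \<alpha>\<^sub>2 p\<^sub>1 p\<^sub>2
    using assms nonisotropic by unfold_locales (auto simp: Omega_def)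
  have R: "P.R = R"
    by (simp add: P.R_def R_def)
  have k: "k\<^sub>1 = P.\<kappa> + \<sigma>\<^sub>1 * \<sigma>\<^sub>2 * (P.S / 2)"
    by (simp add: k\<^sub>1_def P.\<kappa>_def P.S_def \<chi>\<^sub>1_def \<chi>\<^sub>2_def add_divide_distrib)
  have hyp: "hyperbolic_line h L \<longleftrightarrow> \<not> (0 < ?t \<and> ?t < 1)"
    unfolding L_def using hyperbolic_line_iff[OF re] assms ta1 by simp
  have sgn_ta: "sgn ?t = \<sigma>\<^sub>1 * \<sigma>\<^sub>2"
    unfolding \<sigma>\<^sub>1_def \<sigma>\<^sub>2_def using \<open>h p\<^sub>1 p\<^sub>2 \<noteq> 0\<close> by (rule sgn_ta)
  have "?t \<noteq> 0"
    using re \<open>h p\<^sub>1 p\<^sub>2 \<noteq> 0\<close> by (simp add: ta_alt)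
  note S = P.S_pos P.S_bounds
  have neg: "\<exists>n \<in> proj_line p\<^sub>1 p\<^sub>2. Re (h n n) < 0" if "hyperbolic_line h L"
    using hyperbolic_line_negative[OF that] unfolding L_def by blast
  \<comment> \<open>By \<open>P.S_bounds\<close> the open unit interval lies inside the elliptic
    range, so no comparison with \<open>k\<^sub>1\<close> is required.\<close>
  have spherical: "regular_elliptic h R" if t: "0 < ?t" "?t < 1"
  proof -
    have "\<bar>?t - P.\<kappa>\<bar> < P.S / 2"
      using t S by linarith
    then obtain \<mu> \<nu> where "P.tr = \<mu> + \<nu>" "P.dt = \<mu> * \<nu>" "\<mu> \<noteq> \<nu>"
      using P.roots_unit P.abs_\<rho>(1) by blast
    then show ?thesis
      using P.regular_elliptic_spherical spherical_line(2)[OF re t] unfolding R by blast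
  qed
  \<comment> \<open>For \<open>ta > 1\<close> the product of signs is 1 and only the upper endpoint
    can be crossed; for \<open>ta < 0\<close> it is -1, only the lower endpoint matters, and the
    inequalities are reversed.\<close>
  have cases:
    "\<bar>?t - P.\<kappa>\<bar> < P.S / 2 \<longleftrightarrow> \<sigma>\<^sub>1 * \<sigma>\<^sub>2 * ?t < \<sigma>\<^sub>1 * \<sigma>\<^sub>2 * k\<^sub>1"
    "\<bar>?t - P.\<kappa>\<bar> = P.S / 2 \<longleftrightarrow> ?t = k\<^sub>1"
    "\<bar>?t - P.\<kappa>\<bar> > P.S / 2 \<longleftrightarrow> \<sigma>\<^sub>1 * \<sigma>\<^sub>2 * ?t > \<sigma>\<^sub>1 * \<sigma>\<^sub>2 * k\<^sub>1" if "hyperbolic_line h L"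
  proof -
    have "\<not> (0 < ?t \<and> ?t < 1)"
      using that hyp by blast
    then consider "?t > 1" | "?t < 0"
      using ta1 \<open>?t \<noteq> 0\<close> by linarith
    then have "(\<bar>?t - P.\<kappa>\<bar> < P.S / 2 \<longleftrightarrow> \<sigma>\<^sub>1 * \<sigma>\<^sub>2 * ?t < \<sigma>\<^sub>1 * \<sigma>\<^sub>2 * k\<^sub>1)
      \<and> (\<bar>?t - P.\<kappa>\<bar> = P.S / 2 \<longleftrightarrow> ?t = k\<^sub>1)
      \<and> (\<bar>?t - P.\<kappa>\<bar> > P.S / 2 \<longleftrightarrow> \<sigma>\<^sub>1 * \<sigma>\<^sub>2 * ?t > \<sigma>\<^sub>1 * \<sigma>\<^sub>2 * k\<^sub>1)"
    proof cases
      case 1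
      then have prod: "\<sigma>\<^sub>1 * \<sigma>\<^sub>2 = 1"
        using sgn_ta by simp
      then show ?thesis
        using 1 S unfolding k prod abs_if by (intro conjI iffI; simp split: if_splits)
    next
      case 2
      then have prod: "\<sigma>\<^sub>1 * \<sigma>\<^sub>2 = -1"
        using sgn_ta by simp
      then show ?thesis
        using 2 S unfolding k prod abs_if by (intro conjI iffI; simp split: if_splits)
    qed
    then show
      "\<bar>?t - P.\<kappa>\<bar> < P.S / 2 \<longleftrightarrow> \<sigma>\<^sub>1 * \<sigma>\<^sub>2 * ?t < \<sigma>\<^sub>1 * \<sigma>\<^sub>2 * k\<^sub>1"
      "\<bar>?t - P.\<kappa>\<bar> = P.S / 2 \<longleftrightarrow> ?t = k\<^sub>1"
      "\<bar>?t - P.\<kappa>\<bar> > P.S / 2 \<longleftrightarrow> \<sigma>\<^sub>1 * \<sigma>\<^sub>2 * ?t > \<sigma>\<^sub>1 * \<sigma>\<^sub>2 * k\<^sub>1"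
      by auto
  qed
  have elliptic: "regular_elliptic h R" if L: "hyperbolic_line h L" and t: "\<bar>?t - P.\<kappa>\<bar> < P.S / 2"
  proof -
    obtain \<mu> \<nu> where "P.tr = \<mu> + \<nu>" "P.dt = \<mu> * \<nu>" "\<mu> \<noteq> \<nu>" "cmod \<mu> = 1" "cmod \<nu> = 1"
      using P.roots_unit P.abs_\<rho>(1) t by blast
    then show ?thesis
      using P.regular_elliptic_hyperbolic neg[OF L] unfolding R by blast
  qed
  have parabolic: "ellipto_parabolic h R" if L: "hyperbolic_line h L" and t: "\<bar>?t - P.\<kappa>\<bar> = P.S / 2"
  proof -
    obtain \<mu> where "P.tr = 2 * \<mu>" "P.dt = \<mu>\<^sup>2"
      using P.root_double P.abs_\<rho>(2) t by blast
    then show ?thesis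
      using P.ellipto_parabolicI neg[OF L] unfolding R by blast
  qed
  have loxodromic: "loxodromic h R" if L: "hyperbolic_line h L" and t: "\<bar>?t - P.\<kappa>\<bar> > P.S / 2"
  proof -
    obtain \<mu> \<nu> where "P.tr = \<mu> + \<nu>" "P.dt = \<mu> * \<nu>" "\<mu> \<noteq> \<nu>" "cmod \<mu> \<noteq> 1" "cmod \<nu> \<noteq> 1"
      using P.roots_nonunit P.abs_\<rho>(3) t by blast
    then show ?thesis
      using P.loxodromicI neg[OF L] unfolding R by blast
  qed
  \<comment> \<open>The three types exclude each other while the cases are exhaustive, which turns
    the one-way implications above into equivalences.\<close>
  have excl: "\<not> (regular_elliptic h R \<and> ellipto_parabolic h R)"
    "\<not> (regular_elliptic h R \<and> loxodromic h R)" "\<not> (ellipto_parabolic h R \<and> loxodromic h R)"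
    by (auto simp: regular_elliptic_def elliptic_def ellipto_parabolic_def parabolic_def
        loxodromic_def)
  show ?thesis
  proof (cases "hyperbolic_line h L")
    case True
    consider "\<bar>?t - P.\<kappa>\<bar> < P.S / 2" | "\<bar>?t - P.\<kappa>\<bar> = P.S / 2" | "\<bar>?t - P.\<kappa>\<bar> > P.S / 2"
      by linarith
    then show ?thesis
      using True hyp elliptic parabolic loxodromic excl unfolding cases[OF True, symmetric]
      by cases auto
  next
    case False
    then show ?thesis
      using hyp spherical excl by blast
  qed
qed

end
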